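(* Consider the equation with distributed delays $$\dot{x}(t)+a(t)x(t)+\sum_{k=1}^m b_k(t)\int_{h_k(t)}^t x(s)\,d_sR_k(t,s)=0,\quad t\geq 0,$$ where $a,b_1,\dots,b_m:[0,\infty)\to[0,\infty)$ are Lebesgue measurable, essentially bounded and nonnegative; $h_1,\dots,h_m:[0,\infty)\to\mathbb{R}$ are Lebesgue measurable with $h_k(t)\leq t$ and $\lim_{t\to\infty}h_k(t)=\infty$ for each $k$; and, for $k=1,\dots,m$, the functions $R_k(t,s)$ are nondecreasing in $s$ for almost all $t$ and satisfy $\int_{h_k(t)}^t d_sR_k(t,s)\equiv 1$. Suppose there is a constant $a_0$ with $a(t)\geq a_0>0$, that $b_k(t)\geq 0$, that $$h_0:=\limsup_{t\to\infty}\int_{\min_k h_k(t)}^t a(s)\,ds<\infty,$$ and that the inequality $$\frac{1}{\beta}e^{-h_0}>\ln\frac{\beta^2+\beta}{\beta^2+1}$$ holds, where $$b(t)=\sum_{k=1}^m b_k(t),\qquad \beta:=\limsup_{t\to\infty}\frac{b(t)}{a(t)}.$$ Then the equation is exponentially stable.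
   Context: The integrals $\int x(s)\,d_sR_k(t,s)$ are Stieltjes integrals with respect to the variable $s$, for fixed $t$. The initial condition is $x(t)=\varphi(t)$ for $t\leq 0$, where $\varphi:(-\infty,0]\to\mathbb{R}$ is a continuous bounded function. A solution is a function $x$ that is absolutely continuous on $[0,\infty)$ (i.e. on its bounded subintervals), satisfies the equation for almost every $t\geq 0$, and satisfies the initial condition for $t\leq 0$. The equation is exponentially stable if there exist $M>0$ and $\alpha>0$ such that for every initial function $\varphi$ the corresponding solution satisfies $|x(t)|\leq M\|\varphi\|e^{-\alpha t}$ for all $t\geq 0$, where $\|\cdot\|$ is the sup-norm. *)

theory Defs
  imports "HOL-Analysis.Analysis"
begin

(* Lebesgue-Stieltjes integral of f over the closed interval [a, b] with respect to a
   nondecreasing F :: real => real.  interval_measure requires a right-continuous integrator,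
   so F is replaced by its right-limit regularisation, which generates the same measure; thus
   the mass of [a, b] is F(b+) - F(a-), and jumps of F at both endpoints count.  If F is
   constant to the left of a and to the right of b, this is, for continuous f and a < b, the
   Riemann-Stieltjes integral of f over [a, b]. *)
definition stieltjes_integral :: "(real \<Rightarrow> real) \<Rightarrow> real \<Rightarrow> real \<Rightarrow> (real \<Rightarrow> real) \<Rightarrow> real" where
  "stieltjes_integral F a b f =
     (LINT s:{a..b}|interval_measure (\<lambda>u. Lim (at_right u) F). f s)"

definition abs_continuous_interval :: "(real \<Rightarrow> real) \<Rightarrow> real \<Rightarrow> real \<Rightarrow> bool" where
  "abs_continuous_interval f a b \<longleftrightarrow>
     (\<forall>\<epsilon>>0. \<exists>\<delta>>0. \<forall>\<D> S. \<D> division_of S \<and> S \<subseteq> {a..b} \<and> (\<Sum>K\<in>\<D>. Sup K - Inf K) < \<delta>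
        \<longrightarrow> (\<Sum>K\<in>\<D>. \<bar>f (Sup K) - f (Inf K)\<bar>) < \<epsilon>)"

definition admissible_initial :: "(real \<Rightarrow> real) \<Rightarrow> bool" where
  "admissible_initial \<phi> \<longleftrightarrow> continuous_on {..0} \<phi> \<and> bounded (\<phi> ` {..0})"

definition initial_norm :: "(real \<Rightarrow> real) \<Rightarrow> real" where
  "initial_norm \<phi> = (SUP s\<in>{..0}. \<bar>\<phi> s\<bar>)"

(* Only the values of a, b k, h k, R k at times t >= 0 matter. *)
definition is_solution ::
  "nat \<Rightarrow> (real \<Rightarrow> real) \<Rightarrow> (nat \<Rightarrow> real \<Rightarrow> real) \<Rightarrow> (nat \<Rightarrow> real \<Rightarrow> real) \<Rightarrow>
   (nat \<Rightarrow> real \<Rightarrow> real \<Rightarrow> real) \<Rightarrow> (real \<Rightarrow> real) \<Rightarrow> (real \<Rightarrow> real) \<Rightarrow> bool" where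
  "is_solution m a b h R \<phi> x \<longleftrightarrow>
     (\<forall>T\<ge>0. abs_continuous_interval x 0 T) \<and>
     (AE t in lebesgue_on {0..}. \<exists>x'. (x has_real_derivative x') (at t) \<and>
        x' + a t * x t + (\<Sum>k=1..m. b k t * stieltjes_integral (R k t) (h k t) t x) = 0) \<and>
     (\<forall>t\<le>0. x t = \<phi> t)"

(* Well-posedness is not part of stability: the bound is required of whatever solution
   corresponds to the initial function. *)
definition exponentially_stable ::
  "nat \<Rightarrow> (real \<Rightarrow> real) \<Rightarrow> (nat \<Rightarrow> real \<Rightarrow> real) \<Rightarrow> (nat \<Rightarrow> real \<Rightarrow> real) \<Rightarrow>
   (nat \<Rightarrow> real \<Rightarrow> real \<Rightarrow> real) \<Rightarrow> bool" where
  "exponentially_stable m a b h R \<longleftrightarrow>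
     (\<exists>M>0. \<exists>\<alpha>>0. \<forall>\<phi> x. admissible_initial \<phi> \<longrightarrow> is_solution m a b h R \<phi> x \<longrightarrow>
        (\<forall>t\<ge>0. \<bar>x t\<bar> \<le> M * initial_norm \<phi> * exp (- \<alpha> * t)))"

end

(* Let A(t) be the integral of a over [0, t]. For small e > 0 the function y = exp(e A) x obeys an
   equation of the same kind in the clock D = (1 - e) A, with slightly larger feedback B > \<beta> and
   slightly longer delay H > h0; the hypothesis is an open condition, so it survives. Exponential
   decay of x therefore follows from mere boundedness of y.

   Boundedness: once two delays have passed, |y| has no new record. Suppose y(\<tau>) = Q is one. As
   the feedback is negative, y has a last zero \<sigma> before \<tau>, at most H earlier in the clock D. With
   |y| <= Q, integrating y' + D' y <= D' B Q backwards from \<sigma> shows that the undershoot -y(r) is at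
   most B Q (exp(D(\<sigma>) - D(r)) - 1), so at clock time v after \<sigma> the feedback is at most
   B Q min(1, B (exp(H - v) - 1)). Integrating this and maximising over the clock time from \<sigma> to
   \<tau> yields y(\<tau>) < Q because exp(-H) / B > ln ((B^2 + B) / (B^2 + 1)), a contradiction. *)
theory Submission
  imports Defs
begin

subsection \<open>Absolutely continuous functions\<close>

text \<open>A solution obeys its equation only for almost every t, and the clock is differentiable
  only almost everywhere. Each comparison therefore says that some absolutely continuous function
  has a nonpositive derivative off a null set, and no change of time is carried out: a comparison
  function is a primitive \<open>G\<close> in clock time, composed with \<open>D\<close>. The weight
  exp(\<epsilon> A) costs two factors. The damping a drops to (1 - \<epsilon>) a, which is the speed
  of \<open>D\<close>, and expressing x(s) through y(s) inflates the feedback by at most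
  exp(\<epsilon> H) over one delay; both 1 - \<epsilon> and exp(\<epsilon> H) tend to 1 with
  \<epsilon>. Two delays must pass because the last zero may lie one delay before the record, and
  the feedback right after that zero looks back another. The Stieltjes terms are averages of total
  mass one, so bounds of y on the delay window carry over to them and all kernels are treated at
  once. Boundedness by the values on a fixed stretch [0, T3] suffices: up to \<open>T3\<close> the
  solution grows at most exponentially and linearly in the initial norm, which makes M independent
  of the initial function.\<close>

lemma abs_continuous_interval_subset:
  assumes "abs_continuous_interval f p q" "p \<le> p'" "q' \<le> q"
  shows "abs_continuous_interval f p' q'"
proof -
  have "{p'..q'} \<subseteq> {p..q}" using assms by auto
  then show ?thesis
    using assms(1) unfolding abs_continuous_interval_def by (meson order_trans)
qed

text \<open>One domination principle yields all closure properties: differences, products and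
  negatives, and, with both \<open>f\<close> and \<open>g\<close> the identity, Lipschitz
  functions.\<close>

lemma abs_continuous_interval_dominated:
  assumes f: "abs_continuous_interval f p q" and g: "abs_continuous_interval g p q"
    and dom: "\<And>u v. \<lbrakk>p \<le> u; u \<le> v; v \<le> q\<rbrakk> \<Longrightarrow> \<bar>F v - F u\<bar> \<le> L * (\<bar>f v - f u\<bar> + \<bar>g v - g u\<bar>)"
    and "L > 0"
  shows "abs_continuous_interval F p q"
  unfolding abs_continuous_interval_def
proof (intro allI impI)
  fix e :: real assume "0 < e"
  then have e2: "0 < e / (2 * L)" using \<open>L > 0\<close> by simp
  obtain d1 where d1: "d1 > 0"
    "\<And>\<D> S. \<lbrakk>\<D> division_of S; S \<subseteq> {p..q}; (\<Sum>K\<in>\<D>. Sup K - Inf K) < d1\<rbrakk>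
        \<Longrightarrow> (\<Sum>K\<in>\<D>. \<bar>f (Sup K) - f (Inf K)\<bar>) < e / (2 * L)"
    using f e2 unfolding abs_continuous_interval_def by metis
  obtain d2 where d2: "d2 > 0"
    "\<And>\<D> S. \<lbrakk>\<D> division_of S; S \<subseteq> {p..q}; (\<Sum>K\<in>\<D>. Sup K - Inf K) < d2\<rbrakk>
        \<Longrightarrow> (\<Sum>K\<in>\<D>. \<bar>g (Sup K) - g (Inf K)\<bar>) < e / (2 * L)"
    using g e2 unfolding abs_continuous_interval_def by metis
  show "\<exists>\<delta>>0. \<forall>\<D> S. \<D> division_of S \<and> S \<subseteq> {p..q} \<and> (\<Sum>K\<in>\<D>. Sup K - Inf K) < \<delta>
        \<longrightarrow> (\<Sum>K\<in>\<D>. \<bar>F (Sup K) - F (Inf K)\<bar>) < e"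
  proof (intro exI[of _ "min d1 d2"] conjI allI impI)
    show "0 < min d1 d2" using d1 d2 by simp
    fix \<D> :: "real set set" and S
    assume "\<D> division_of S \<and> S \<subseteq> {p..q} \<and> (\<Sum>K\<in>\<D>. Sup K - Inf K) < min d1 d2"
    then have *: "\<D> division_of S" "S \<subseteq> {p..q}"
      "(\<Sum>K\<in>\<D>. Sup K - Inf K) < d1" "(\<Sum>K\<in>\<D>. Sup K - Inf K) < d2" by auto
    have "(\<Sum>K\<in>\<D>. \<bar>F (Sup K) - F (Inf K)\<bar>)
        \<le> (\<Sum>K\<in>\<D>. L * (\<bar>f (Sup K) - f (Inf K)\<bar> + \<bar>g (Sup K) - g (Inf K)\<bar>))"
    proof (rule sum_mono)
      fix K assume K: "K \<in> \<D>"
      obtain u v where "K = {u..v}" using division_ofD(4)[OF *(1) K] by auto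
      moreover have "K \<noteq> {}" using division_ofD(3)[OF *(1) K] .
      moreover have "K \<subseteq> {p..q}" using division_ofD(2)[OF *(1) K] *(2) by blast
      ultimately show "\<bar>F (Sup K) - F (Inf K)\<bar>
          \<le> L * (\<bar>f (Sup K) - f (Inf K)\<bar> + \<bar>g (Sup K) - g (Inf K)\<bar>)"
        using dom[of u v] by simp
    qed
    also have "\<dots> = L * ((\<Sum>K\<in>\<D>. \<bar>f (Sup K) - f (Inf K)\<bar>) + (\<Sum>K\<in>\<D>. \<bar>g (Sup K) - g (Inf K)\<bar>))"
      by (simp add: sum.distrib flip: sum_distrib_left)
    also have "\<dots> < L * (e / (2 * L) + e / (2 * L))"
      using d1(2)[OF *(1-3)] d2(2)[OF *(1,2,4)] \<open>L > 0\<close>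
      by (intro mult_strict_left_mono add_strict_mono)
    also have "\<dots> = e" using \<open>L > 0\<close> by simp
    finally show "(\<Sum>K\<in>\<D>. \<bar>F (Sup K) - F (Inf K)\<bar>) < e" .
  qed
qed

lemma abs_continuous_interval_ident: "abs_continuous_interval (\<lambda>t. t) p q"
  unfolding abs_continuous_interval_def
proof (intro allI impI)
  fix e :: real assume "0 < e"
  have "(\<Sum>K\<in>\<D>. \<bar>Sup K - Inf K\<bar>) = (\<Sum>K\<in>\<D>. Sup K - Inf K)" if div: "\<D> division_of S"
    for \<D> :: "real set set" and S
  proof (rule sum.cong)
    fix K assume K: "K \<in> \<D>"
    obtain u v where "K = {u..v}" using division_ofD(4)[OF div K] by auto
    moreover have "K \<noteq> {}" using division_ofD(3)[OF div K] .
    ultimately show "\<bar>Sup K - Inf K\<bar> = Sup K - Inf K" by simp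
  qed auto
  then show "\<exists>\<delta>>0. \<forall>\<D> S. \<D> division_of S \<and> S \<subseteq> {p..q} \<and> (\<Sum>K\<in>\<D>. Sup K - Inf K) < \<delta>
        \<longrightarrow> (\<Sum>K\<in>\<D>. \<bar>Sup K - Inf K\<bar>) < e"
    using \<open>0 < e\<close> by (intro exI[of _ e]) auto
qed

lemma abs_continuous_interval_lipschitz:
  fixes f :: "real \<Rightarrow> real"
  assumes "L-lipschitz_on {p..q} f"
  shows "abs_continuous_interval f p q"
proof (rule abs_continuous_interval_dominated[OF abs_continuous_interval_ident abs_continuous_interval_ident])
  show "0 < L + 1" using lipschitz_on_nonneg[OF assms] by simp
  fix u v assume uv: "p \<le> u" "u \<le> v" "v \<le> q"
  then have "\<bar>f v - f u\<bar> \<le> L * \<bar>v - u\<bar>"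
    using lipschitz_onD[OF assms, of v u] by (auto simp: dist_real_def)
  also have "\<dots> \<le> (L + 1) * (\<bar>v - u\<bar> + \<bar>v - u\<bar>)"
    using lipschitz_on_nonneg[OF assms] by (intro mult_mono) auto
  finally show "\<bar>f v - f u\<bar> \<le> (L + 1) * (\<bar>v - u\<bar> + \<bar>v - u\<bar>)" .
qed

lemma abs_continuous_interval_imp_continuous_on:
  assumes ac: "abs_continuous_interval f p q"
  shows "continuous_on {p..q} f"
  unfolding continuous_on_iff
proof (intro ballI allI impI)
  fix x e :: real assume x: "x \<in> {p..q}" and "0 < e"
  then obtain d where d: "d > 0"
    "\<And>\<D> S. \<lbrakk>\<D> division_of S; S \<subseteq> {p..q}; (\<Sum>K\<in>\<D>. Sup K - Inf K) < d\<rbrakk>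
        \<Longrightarrow> (\<Sum>K\<in>\<D>. \<bar>f (Sup K) - f (Inf K)\<bar>) < e"
    using ac unfolding abs_continuous_interval_def by metis
  have less: "\<bar>f v - f u\<bar> < e" if "u \<le> v" "p \<le> u" "v \<le> q" "v - u < d" for u v
    using d(2)[of "{{u..v}}" "{u..v}"] that division_of_self[of u v] by auto
  have "dist (f x') (f x) < e" if "x' \<in> {p..q}" "dist x' x < d" for x'
    using less[of x x'] less[of x' x] that x by (cases "x \<le> x'") (auto simp: dist_real_def abs_minus_commute)
  then show "\<exists>d>0. \<forall>x'\<in>{p..q}. dist x' x < d \<longrightarrow> dist (f x') (f x) < e" using d(1) by blast
qed

lemma abs_continuous_interval_diff:
  assumes "abs_continuous_interval f p q" "abs_continuous_interval g p q"
  shows "abs_continuous_interval (\<lambda>t. f t - g t) p q"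
  by (rule abs_continuous_interval_dominated[OF assms, of _ 1]) auto

lemma abs_continuous_interval_mult:
  assumes "abs_continuous_interval f p q" "abs_continuous_interval g p q"
  shows "abs_continuous_interval (\<lambda>t. f t * g t) p q"
proof -
  have bdd: "\<exists>C>0. \<forall>t\<in>{p..q}. \<bar>h t\<bar> \<le> C" if "abs_continuous_interval h p q" for h
    using compact_imp_bounded[OF compact_continuous_image[OF
          abs_continuous_interval_imp_continuous_on[OF that] compact_Icc]]
    unfolding bounded_pos by auto
  obtain C where C: "C > 0" "\<And>t. t \<in> {p..q} \<Longrightarrow> \<bar>f t\<bar> \<le> C" using bdd[OF assms(1)] by blast
  obtain D where D: "D > 0" "\<And>t. t \<in> {p..q} \<Longrightarrow> \<bar>g t\<bar> \<le> D" using bdd[OF assms(2)] by blast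
  show ?thesis
  proof (rule abs_continuous_interval_dominated[OF assms])
    show "0 < C + D" using C D by simp
    fix u v assume uv: "p \<le> u" "u \<le> v" "v \<le> q"
    have "\<bar>f v * g v - f u * g u\<bar> = \<bar>(f v - f u) * g v + f u * (g v - g u)\<bar>"
      by (simp add: algebra_simps)
    also have "\<dots> \<le> \<bar>f v - f u\<bar> * \<bar>g v\<bar> + \<bar>f u\<bar> * \<bar>g v - g u\<bar>"
      using abs_triangle_ineq[of "(f v - f u) * g v" "f u * (g v - g u)"] by (simp add: abs_mult)
    also have "\<dots> \<le> \<bar>f v - f u\<bar> * (C + D) + (C + D) * \<bar>g v - g u\<bar>"
    proof (intro add_mono mult_mono)
      show "\<bar>g v\<bar> \<le> C + D" using D(2)[of v] C(1) uv by simp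
      show "\<bar>f u\<bar> \<le> C + D" using C(2)[of u] D(1) uv by simp
    qed (use C D in auto)
    finally show "\<bar>f v * g v - f u * g u\<bar> \<le> (C + D) * (\<bar>f v - f u\<bar> + \<bar>g v - g u\<bar>)"
      by (simp add: algebra_simps)
  qed
qed

text \<open>On a compact interval \<open>D\<close> takes values in some [-r, r], where the
  derivative of \<open>G\<close> is bounded. This makes integrating factors and primitives composed
  with the clock absolutely continuous.\<close>

lemma lipschitz_on_C1_compose:
  fixes D :: "real \<Rightarrow> real"
  assumes D: "L-lipschitz_on {p..q} D"
    and G: "\<And>v. (G has_real_derivative G' v) (at v)" "continuous_on UNIV G'"
  shows "\<exists>M. M-lipschitz_on {p..q} (\<lambda>t. G (D t))"
proof -
  have "bounded (D ` {p..q})"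
    using compact_continuous_image[OF lipschitz_on_continuous_on[OF D] compact_Icc]
    by (rule compact_imp_bounded)
  then obtain r where "\<forall>x\<in>D ` {p..q}. norm x \<le> r"
    unfolding bounded_iff by blast
  then have r: "D ` {p..q} \<subseteq> {-r..r}" by (auto simp: abs_le_iff minus_le_iff)
  have "bounded (G' ` {-r..r})"
    by (intro compact_imp_bounded compact_continuous_image continuous_on_subset[OF G(2)]) auto
  then obtain C where C: "C > 0" "\<And>v. v \<in> {-r..r} \<Longrightarrow> \<bar>G' v\<bar> \<le> C"
    unfolding bounded_pos by auto
  have "C-lipschitz_on {-r..r} G"
  proof (rule lipschitz_onI)
    fix u v assume "u \<in> {-r..r}" "v \<in> {-r..r}"
    then have "norm (G u - G v) \<le> C * norm (u - v)"
      using G(1) C(2) by (intro field_differentiable_bound[of "{-r..r}" G G'])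
        (auto intro: has_field_derivative_at_within)
    then show "dist (G u) (G v) \<le> C * dist u v" by (simp add: dist_norm)
  qed (use C in simp)
  then show ?thesis
    using lipschitz_on_compose2[OF D] lipschitz_on_subset r by blast
qed

subsection \<open>Monotonicity from the sign of the derivative\<close>

text \<open>Absolute continuity is what rules out growth on the null set \<open>E\<close>, as for
  the Cantor function. The increment is telescoped over a gauge-fine tagged division, so the
  derivative is never integrated.\<close>

lemma abs_continuous_interval_nonincreasing:
  fixes f :: "real \<Rightarrow> real"
  assumes "p \<le> q"
    and ac: "abs_continuous_interval f p q"
    and E: "negligible E"
    and der: "\<And>t. \<lbrakk>t \<in> {p<..<q}; t \<notin> E\<rbrakk> \<Longrightarrow> \<exists>d\<le>0. (f has_real_derivative d) (at t)"
  shows "f q \<le> f p"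
proof (rule field_le_epsilon)
  fix e :: real
  assume "0 < e"
  define e1 where "e1 = e / 2"
  \<comment> \<open>The \<open>+ 1\<close> keeps the denominator positive when
    \<open>p = q\<close>.\<close>
  define e2 where "e2 = e / (2 * (q - p + 1))"
  have e1: "0 < e1" and e2: "0 < e2" and e2_le: "e2 * (q - p) \<le> e / 2"
    using \<open>0 < e\<close> \<open>p \<le> q\<close> by (auto simp: e1_def e2_def field_simps)
  obtain \<delta> where \<delta>: "0 < \<delta>"
    and var: "\<And>\<D> S. \<lbrakk>\<D> division_of S; S \<subseteq> {p..q}; (\<Sum>K\<in>\<D>. Sup K - Inf K) < \<delta>\<rbrakk>
        \<Longrightarrow> (\<Sum>K\<in>\<D>. \<bar>f (Sup K) - f (Inf K)\<bar>) < e1"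
    using ac e1 unfolding abs_continuous_interval_def by metis
  \<comment> \<open>The endpoints may be tags too, but \<open>der\<close> speaks only of interior
    points; they are treated as exceptional.\<close>
  define E' where "E' = E \<union> {p, q}"
  have E': "negligible E'"
    unfolding E'_def using E by (intro negligible_Un) auto
  obtain U where U: "open U" "E' \<subseteq> U" "U \<in> lmeasurable" "measure lebesgue U < \<delta>"
  proof -
    obtain U where U: "open U" "E' \<subseteq> U" "U - E' \<in> lmeasurable" "emeasure lebesgue (U - E') < ennreal \<delta>"
      using sets_lebesgue_outer_open \<delta> E' negligible_imp_sets by metis
    have 1: "E' \<in> lmeasurable" "measure lebesgue E' = 0"
      using E' negligible_iff_measure by auto
    have Ueq: "U = (U - E') \<union> E'" using U by auto
    have "U \<in> lmeasurable" using 1 U(3) Ueq fmeasurable.Un by metis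
    moreover have "measure lebesgue (U - E') < \<delta>"
      using U(3,4) \<delta> by (metis emeasure_eq_measure2 ennreal_less_iff measure_nonneg)
    moreover have "measure lebesgue U \<le> measure lebesgue (U - E') + measure lebesgue E'"
      using measure_Un_le[of "U - E'" lebesgue E'] Ueq U(3) 1 by (simp add: fmeasurableD)
    ultimately show ?thesis using that U 1 by auto
  qed
  \<comment> \<open>Straddle estimate: as the tag lies between \<open>u\<close> and
    \<open>v\<close>, the two error terms add up to a multiple of \<open>v - u\<close>
    itself.\<close>
  have "\<exists>r>0. \<forall>u v. u \<le> t \<and> t \<le> v \<and> \<bar>u - t\<bar> < r \<and> \<bar>v - t\<bar> < r \<longrightarrow> f v - f u \<le> e2 * (v - u)"
    if t: "t \<in> {p<..<q}" "t \<notin> E" for t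
  proof -
    obtain d where d: "d \<le> 0" "(f has_real_derivative d) (at t)" using der[OF t] by auto
    then obtain r where r: "r > 0"
      "\<And>y. \<bar>y - t\<bar> < r \<Longrightarrow> \<bar>f y - f t - d * (y - t)\<bar> \<le> e2 * \<bar>y - t\<bar>"
      using e2 unfolding has_field_derivative_def has_derivative_at_alt by auto
    have "f v - f u \<le> e2 * (v - u)"
      if "u \<le> t" "t \<le> v" "\<bar>u - t\<bar> < r" "\<bar>v - t\<bar> < r" for u v
    proof -
      have "f v - f t \<le> d * (v - t) + e2 * (v - t)" using r(2)[of v] that by simp
      moreover have "f t - f u \<le> d * (t - u) + e2 * (t - u)"
        using r(2)[of u] that by (simp add: algebra_simps)
      ultimately have "f v - f u \<le> d * (v - u) + e2 * (v - u)" by (simp add: algebra_simps)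
      moreover have "d * (v - u) \<le> 0" using d that by (simp add: mult_nonpos_nonneg)
      ultimately show ?thesis by simp
    qed
    then show ?thesis using r(1) by blast
  qed
  then obtain r where r: "\<And>t. \<lbrakk>t \<in> {p<..<q}; t \<notin> E\<rbrakk> \<Longrightarrow> r t > 0"
    "\<And>t u v. \<lbrakk>t \<in> {p<..<q}; t \<notin> E; u \<le> t; t \<le> v; \<bar>u - t\<bar> < r t; \<bar>v - t\<bar> < r t\<rbrakk>
       \<Longrightarrow> f v - f u \<le> e2 * (v - u)"
    by metis
  \<comment> \<open>Cells tagged in the null set lie in the small open set \<open>U\<close>, so absolute continuity controls them;
    all other cells are controlled by the derivative at the tag.\<close>
  define \<gamma> where "\<gamma> = (\<lambda>t. if t \<in> E' then U else ball t (if t \<in> {p<..<q} then r t else 1))"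
  have "gauge \<gamma>"
    unfolding gauge_def \<gamma>_def using U r(1) by (auto simp: E'_def)
  then obtain D where D: "D tagged_division_of {p..q}" "\<gamma> fine D"
    using fine_division_exists_real by blast
  note DD = tagged_division_ofD[OF D(1)]
  define D1 where "D1 = {xK \<in> D. fst xK \<in> E'}"
  have D1sub: "D1 \<subseteq> D" by (auto simp: D1_def)
  have interval: "\<exists>u v. K = {u..v} \<and> u \<le> t \<and> t \<le> v" if "(t, K) \<in> D" for t K
    using DD(2)[OF that] DD(4)[OF that] by auto
  have D1p: "D1 tagged_partial_division_of {p..q}"
    using D(1) D1sub tagged_partial_division_subset unfolding tagged_division_of_def by metis
  note D1t = tagged_partial_division_of_Union_self[OF D1p]
  note D1d = division_of_tagged_division[OF D1t]
  have sumK: "(\<Sum>(t, K)\<in>D1. g (Inf K) (Sup K)) = (\<Sum>K\<in>snd ` D1. g (Inf K) (Sup K))"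
    if g: "\<And>u. g u u = 0" for g :: "real \<Rightarrow> real \<Rightarrow> real"
  proof -
    \<comment> \<open>The lemma on sums over tagged divisions also asks for the value on the empty
      interval, where \<open>Inf\<close> and \<open>Sup\<close> carry no information; it is set to 0
      there.\<close>
    define G where "G K = (if K = {} then 0 else g (Inf K) (Sup K))" for K
    have ne: "K \<noteq> {}" if "(t, K) \<in> D1" for t K
      using that DD(2) D1sub by blast
    have "(\<Sum>(t, K)\<in>D1. g (Inf K) (Sup K)) = (\<Sum>(t, K)\<in>D1. G K)"
      using ne by (intro sum.cong) (auto simp: G_def)
    also have "\<dots> = (\<Sum>K\<in>snd ` D1. G K)"
    proof (rule sum.over_tagged_division_lemma[OF D1t])
      show "G (cbox u v) = 0" if "box u v = {}" for u v
        using that g by (cases "u = v") (auto simp: G_def)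
    qed
    also have "\<dots> = (\<Sum>K\<in>snd ` D1. g (Inf K) (Sup K))"
      using ne by (intro sum.cong) (auto simp: G_def)
    finally show ?thesis .
  qed
  have "(\<Sum>K\<in>snd ` D1. Sup K - Inf K) = (\<Sum>K\<in>snd ` D1. measure lebesgue K)"
  proof (rule sum.cong)
    fix K assume "K \<in> snd ` D1"
    then obtain t where "(t, K) \<in> D" using D1sub by auto
    then obtain u v where "K = {u..v}" "u \<le> v" using interval order_trans by metis
    then show "Sup K - Inf K = measure lebesgue K" by simp
  qed auto
  also have "\<dots> = measure lebesgue (\<Union> (snd ` D1))"
    by (rule content_division[OF D1d])
  also have "\<dots> \<le> measure lebesgue U"
  proof (rule measure_mono_fmeasurable)
    show "\<Union> (snd ` D1) \<subseteq> U"
    proof (rule Union_least)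
      fix K assume "K \<in> snd ` D1"
      then obtain t where "(t, K) \<in> D" "t \<in> E'" by (auto simp: D1_def)
      then show "K \<subseteq> U" using fineD[OF D(2), of t K] by (simp add: \<gamma>_def)
    qed
    show "\<Union> (snd ` D1) \<in> sets lebesgue"
      using lmeasurable_division[OF D1d] by (rule fmeasurableD)
  qed (rule U)
  finally have small: "(\<Sum>K\<in>snd ` D1. Sup K - Inf K) < \<delta>" using U by linarith
  have "(\<Sum>(t, K)\<in>D1. f (Sup K) - f (Inf K)) \<le> (\<Sum>K\<in>snd ` D1. \<bar>f (Sup K) - f (Inf K)\<bar>)"
    using sumK[of "\<lambda>u v. f v - f u"] by (auto intro!: sum_mono)
  also have "\<dots> < e1"
  proof (rule var[OF D1d _ small])
    show "\<Union> (snd ` D1) \<subseteq> {p..q}"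
    proof (rule Union_least)
      fix K assume "K \<in> snd ` D1"
      then obtain t where "(t, K) \<in> D" using D1sub by auto
      then show "K \<subseteq> {p..q}" by (rule DD(3))
    qed
  qed
  finally have S1: "(\<Sum>(t, K)\<in>D1. f (Sup K) - f (Inf K)) \<le> e / 2" by (simp add: e1_def)
  have "(\<Sum>(t, K)\<in>D - D1. f (Sup K) - f (Inf K)) \<le> (\<Sum>(t, K)\<in>D - D1. e2 * (Sup K - Inf K))"
  proof (rule sum_mono, clarify)
    fix t K assume tK: "(t, K) \<in> D" "(t, K) \<notin> D1"
    obtain u v where uv: "K = {u..v}" "u \<le> t" "t \<le> v" using interval[OF tK(1)] by blast
    have "t \<in> {p..q}" using DD(2,3)[OF tK(1)] by auto
    then have t: "t \<in> {p<..<q}" "t \<notin> E" "t \<notin> E'" using tK unfolding D1_def E'_def by auto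
    have "K \<subseteq> ball t (r t)" using fineD[OF D(2) tK(1)] t by (simp add: \<gamma>_def)
    then have "u \<in> ball t (r t)" "v \<in> ball t (r t)" using uv by (auto simp del: mem_ball)
    then have "\<bar>u - t\<bar> < r t" "\<bar>v - t\<bar> < r t" by (auto simp: dist_real_def)
    with r(2)[OF t(1,2) uv(2,3)] uv
    show "f (Sup K) - f (Inf K) \<le> e2 * (Sup K - Inf K)" by simp
  qed
  also have "\<dots> \<le> (\<Sum>(t, K)\<in>D. e2 * (Sup K - Inf K))"
  proof (rule sum_mono2)
    fix b assume "b \<in> D - (D - D1)"
    then obtain t K where b: "b = (t, K)" "(t, K) \<in> D" by (cases b) auto
    then obtain u v where "K = {u..v}" "u \<le> v" using interval order_trans by metis
    then show "0 \<le> (case b of (t, K) \<Rightarrow> e2 * (Sup K - Inf K))"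
      using e2 b by simp
  qed (use DD(1) in auto)
  also have "\<dots> = e2 * (q - p)"
    using additive_tagged_division_1[OF \<open>p \<le> q\<close> D(1), of "\<lambda>t. e2 * t"]
    by (simp add: algebra_simps case_prod_unfold)
  finally have S2: "(\<Sum>(t, K)\<in>D - D1. f (Sup K) - f (Inf K)) \<le> e / 2" using e2_le by simp
  have "f q - f p = (\<Sum>(t, K)\<in>D. f (Sup K) - f (Inf K))"
    using additive_tagged_division_1[OF \<open>p \<le> q\<close> D(1)] by metis
  also have "\<dots> = (\<Sum>(t, K)\<in>D - D1. f (Sup K) - f (Inf K)) + (\<Sum>(t, K)\<in>D1. f (Sup K) - f (Inf K))"
    using sum.subset_diff[OF D1sub DD(1)] .
  finally show "f q \<le> f p + e" using S1 S2 by simp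
qed

subsection \<open>Lebesgue differentiation of an indefinite integral\<close>

text \<open>Where the derivative fails, arbitrarily short intervals have a large Henstock defect; disjoint
  such intervals selected by Vitali's theorem have a small total defect by Henstock's lemma.\<close>

lemma negligible_not_differentiable_integral:
  fixes f :: "real \<Rightarrow> real"
  assumes f: "f integrable_on {p..q}"
  shows "negligible {t \<in> {p<..<q}.
    \<not> ((\<lambda>s. integral {p..s} f) has_real_derivative f t) (at t)}"
proof -
  define F where "F = (\<lambda>s. integral {p..s} f)"
  have F_diff: "F v - F u = integral {u..v} f" if "p \<le> u" "u \<le> v" "v \<le> q" for u v
  proof -
    have "f integrable_on {p..v}"
      using f that by (elim integrable_on_subinterval) auto
    from Henstock_Kurzweil_Integration.integral_combine[OF that(1,2) this] show ?thesis
      by (simp add: F_def algebra_simps)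
  qed
  define bad where "bad e t s \<longleftrightarrow> s \<noteq> t \<and> s \<in> {p<..<q} \<and> e * \<bar>s - t\<bar> < \<bar>F s - F t - f t * (s - t)\<bar>"
    for e t s
  define B where "B e = {t \<in> {p<..<q}. \<forall>d>0. \<exists>s. \<bar>s - t\<bar> < d \<and> bad e t s}" for e
  have neg: "negligible (B e)" if "e > 0" for e
    unfolding negligible_outer_le
  proof (intro allI impI)
    fix \<epsilon> :: real
    assume "\<epsilon> > 0"
    \<comment> \<open>A ball has length \<open>2 * rad i\<close> and its cell a defect above
      \<open>e * rad i\<close>, so a total defect below \<open>\<eta>\<close> means a total length
      below \<open>2 / e * \<eta>\<close>, which is \<open>\<epsilon>\<close>.\<close>
    define \<eta> where "\<eta> = \<epsilon> * e / 2"
    have "\<eta> > 0" using \<open>\<epsilon> > 0\<close> \<open>e > 0\<close> by (simp add: \<eta>_def)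
    obtain \<gamma> where \<gamma>: "gauge \<gamma>"
      "\<And>D. \<lbrakk>D tagged_partial_division_of {p..q}; \<gamma> fine D\<rbrakk> \<Longrightarrow>
         (\<Sum>(x,k)\<in>D. norm (measure lborel k *\<^sub>R f x - integral k f)) < \<eta>"
      using Henstock_lemma[of f p q \<eta>] f \<open>\<eta> > 0\<close> by auto
    \<comment> \<open>A pair consists of a point and a witness of its failure. Vitali's theorem
      selects balls centred at the point, while Henstock's lemma is applied to the half
      \<open>J\<close> between point and witness; the last condition makes that cell
      \<open>\<gamma>\<close>-fine.\<close>
    define K where "K = {(t, s). t \<in> {p<..<q} \<and> bad e t s \<and> cball t \<bar>s - t\<bar> \<subseteq> \<gamma> t}"
    define rad where "rad i = \<bar>snd i - fst i\<bar>" for i :: "real \<times> real"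
    have cover: "\<exists>i. i \<in> K \<and> t \<in> ball (fst i) (rad i) \<and> rad i < d" if t: "t \<in> B e" "0 < d" for t d
    proof -
      obtain r where r: "r > 0" "ball t r \<subseteq> \<gamma> t"
        using \<gamma>(1) unfolding gauge_def by (meson open_contains_ball)
      obtain s where s: "\<bar>s - t\<bar> < min d r" "bad e t s"
        using t r unfolding B_def by (auto elim!: allE[of _ "min d r"])
      have "cball t \<bar>s - t\<bar> \<subseteq> \<gamma> t" using r(2) s(1) by (force simp: subset_iff)
      then show ?thesis
        using s t by (intro exI[of _ "(t, s)"]) (auto simp: K_def B_def rad_def bad_def)
    qed
    obtain C where C: "countable C" "C \<subseteq> K"
      "pairwise (\<lambda>i j. disjnt (ball (fst i) (rad i)) (ball (fst j) (rad j))) C"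
      "negligible (B e - (\<Union>i\<in>C. ball (fst i) (rad i)))"
      by (rule Vitali_covering_theorem_balls[of "B e" K fst rad]) (use cover in blast, blast)
    define N where "N = B e - (\<Union>i\<in>C. ball (fst i) (rad i))"
    have rad_pos: "0 < rad i" if "i \<in> C" for i
      using that C(2) by (auto simp: K_def bad_def rad_def)
    define J where "J i = {min (fst i) (snd i)..max (fst i) (snd i)}" for i :: "real \<times> real"
    have interior_J: "interior (J i) \<subseteq> ball (fst i) (rad i)" for i
      by (auto simp: J_def rad_def dist_real_def interior_atLeastAtMost_real)
    have bound: "measure lebesgue (\<Union>i\<in>I. ball (fst i) (rad i)) \<le> \<epsilon>" if I: "I \<subseteq> C" "finite I" for I
    proof -
      define D where "D = (\<lambda>i. (fst i, J i)) ` I"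
      have disj: "interior (J i) \<inter> interior (J j) = {}" if "i \<in> I" "j \<in> I" "i \<noteq> j" for i j
        using C(3) that I(1) interior_J[of i] interior_J[of j]
        unfolding pairwise_def disjnt_def by blast
      have inj: "inj_on (\<lambda>i. (fst i, J i)) I"
      proof (rule inj_onI, rule ccontr)
        fix i j assume ij: "i \<in> I" "j \<in> I" "(fst i, J i) = (fst j, J j)" "i \<noteq> j"
        from disj[OF ij(1,2,4)] have "interior (J i) = {}" using ij(3) by simp
        with rad_pos[of i] ij I(1) show False
          by (auto simp: J_def rad_def interior_atLeastAtMost_real)
      qed
      have part: "D tagged_partial_division_of {p..q}"
        unfolding tagged_partial_division_of_def
      proof (intro conjI allI impI)
        show "finite D" using I by (simp add: D_def)
        fix x L assume "(x, L) \<in> D"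
        then obtain i where i: "i \<in> I" "x = fst i" "L = J i" by (auto simp: D_def)
        then show "x \<in> L" "\<exists>a b. L = cbox a b" by (auto simp: J_def)
        have "i \<in> K" using i I C by blast
        then show "L \<subseteq> {p..q}" using i by (auto simp: K_def bad_def J_def)
      next
        fix x1 K1 x2 K2 assume "(x1, K1) \<in> D \<and> (x2, K2) \<in> D \<and> (x1, K1) \<noteq> (x2, K2)"
        then show "interior K1 \<inter> interior K2 = {}" using disj by (force simp: D_def)
      qed
      have fine: "\<gamma> fine D"
      proof (rule fineI)
        fix x L assume "(x, L) \<in> D"
        then obtain i where i: "i \<in> I" "x = fst i" "L = J i" by (auto simp: D_def)
        have "i \<in> K" using i I C by blast
        then have "cball x (rad i) \<subseteq> \<gamma> x" using i by (auto simp: K_def rad_def)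
        moreover have "L \<subseteq> cball x (rad i)" using i by (auto simp: J_def rad_def dist_real_def)
        ultimately show "L \<subseteq> \<gamma> x" by blast
      qed
      have "measure lebesgue (\<Union>i\<in>I. ball (fst i) (rad i)) \<le> (\<Sum>i\<in>I. measure lebesgue (ball (fst i) (rad i)))"
        using I by (intro measure_UNION_le) auto
      also have "\<dots> = (\<Sum>i\<in>I. 2 * rad i)"
        using rad_pos I by (intro sum.cong) (auto simp: ball_eq_greaterThanLessThan subset_iff less_imp_le)
      also have "\<dots> = 2 / e * (\<Sum>i\<in>I. e * rad i)"
        using \<open>e > 0\<close> by (simp add: sum_distrib_left)
      also have "(\<Sum>i\<in>I. e * rad i) \<le> (\<Sum>i\<in>I. norm (measure lborel (J i) *\<^sub>R f (fst i) - integral (J i) f))"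
      proof (rule sum_mono)
        fix i assume "i \<in> I"
        then have "i \<in> K" using I C by blast
        then obtain t s where i: "i = (t, s)" "t \<in> {p<..<q}" "bad e t s" by (auto simp: K_def)
        have "norm (measure lborel (J i) *\<^sub>R f (fst i) - integral (J i) f) = \<bar>F s - F t - f t * (s - t)\<bar>"
        proof (cases "t \<le> s")
          case True
          then show ?thesis using F_diff[of t s] i by (auto simp: J_def bad_def algebra_simps abs_minus_commute)
        next
          case False
          then show ?thesis using F_diff[of s t] i by (auto simp: J_def bad_def algebra_simps abs_minus_commute)
        qed
        then show "e * rad i \<le> norm (measure lborel (J i) *\<^sub>R f (fst i) - integral (J i) f)"
          using i by (auto simp: bad_def rad_def)
      qed
      also have "\<dots> = (\<Sum>(x,k)\<in>D. norm (measure lborel k *\<^sub>R f x - integral k f))"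
        unfolding D_def by (simp add: sum.reindex[OF inj])
      also have "\<dots> < \<eta>" using \<gamma>(2)[OF part fine] .
      finally show ?thesis using \<open>e > 0\<close> by (simp add: \<eta>_def divide_simps mult.commute)
    qed
    have fm: "(\<Union>i\<in>C. ball (fst i) (rad i)) \<in> lmeasurable"
      by (rule fmeasurable_UN_bound[OF C(1) _ bound]) auto
    have mb: "measure lebesgue (\<Union>i\<in>C. ball (fst i) (rad i)) \<le> \<epsilon>"
      by (rule measure_UN_bound[OF C(1) _ bound]) auto
    have N: "N \<in> lmeasurable" "measure lebesgue N = 0"
      using C(4) negligible_iff_measure by (auto simp: N_def)
    let ?T = "(\<Union>i\<in>C. ball (fst i) (rad i)) \<union> N"
    have "measure lebesgue ?T \<le> \<epsilon>"
      using measure_Un_le[of "\<Union>i\<in>C. ball (fst i) (rad i)" lebesgue N] fm mb N by (simp add: fmeasurableD)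
    moreover have "B e \<subseteq> ?T" by (auto simp: N_def)
    moreover have "?T \<in> lmeasurable" using fm N by auto
    ultimately show "\<exists>T. B e \<subseteq> T \<and> T \<in> lmeasurable \<and> measure lebesgue T \<le> \<epsilon>" by blast
  qed
  have "negligible (\<Union>n. B (inverse (real (Suc n))))"
    by (intro negligible_Union_nat neg) simp
  then show ?thesis
  proof (rule negligible_subset, intro subsetI)
    fix t assume "t \<in> {t \<in> {p<..<q}. \<not> ((\<lambda>s. integral {p..s} f) has_real_derivative f t) (at t)}"
    then have t: "t \<in> {p<..<q}" "\<not> (F has_real_derivative f t) (at t)" by (auto simp: F_def)
    obtain e where e: "e > 0" "\<And>d. d > 0 \<Longrightarrow> \<exists>y. \<bar>y - t\<bar> < d \<and> e * \<bar>y - t\<bar> < \<bar>F y - F t - f t * (y - t)\<bar>"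
      using t(2) bounded_linear_mult_right[of "f t"]
      unfolding has_field_derivative_def has_derivative_at_alt by (auto simp: not_le)
    obtain n where n: "inverse (real (Suc n)) < e" using reals_Archimedean[OF e(1)] by blast
    have "t \<in> B (inverse (real (Suc n)))"
      unfolding B_def
    proof (intro CollectI conjI allI impI t(1))
      fix d :: real assume "d > 0"
      \<comment> \<open>Shrinking \<open>d\<close> keeps the witness inside the open interval, as
        \<open>bad\<close> demands.\<close>
      define d' where "d' = min d (min (t - p) (q - t))"
      have "d' > 0" using \<open>d > 0\<close> t by (auto simp: d'_def)
      then obtain y where y: "\<bar>y - t\<bar> < d'" "e * \<bar>y - t\<bar> < \<bar>F y - F t - f t * (y - t)\<bar>" using e(2) by blast
      have "inverse (real (Suc n)) * \<bar>y - t\<bar> \<le> e * \<bar>y - t\<bar>" using n by (intro mult_right_mono) auto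
      with y have "bad (inverse (real (Suc n))) t y" unfolding bad_def d'_def by auto
      with y show "\<exists>s. \<bar>s - t\<bar> < d \<and> bad (inverse (real (Suc n))) t s" unfolding d'_def by auto
    qed
    then show "t \<in> (\<Union>n. B (inverse (real (Suc n))))" by blast
  qed
qed

subsection \<open>Absence of new records\<close>

text \<open>\<open>exp (D t)\<close> is the integrating factor for y' + D' y, and
  \<open>G (D t)\<close> absorbs the right-hand side by the chain rule. Continuity of
  \<open>\<kappa>\<close> makes \<open>G (D t)\<close> Lipschitz on bounded intervals.\<close>

lemma absolutely_continuous_comparison:
  fixes y D :: "real \<Rightarrow> real"
  assumes "p \<le> q"
    and y: "abs_continuous_interval y p q"
    and D: "L-lipschitz_on {p..q} D"
    and E: "negligible E"
    and ineq: "\<And>t. \<lbrakk>t \<in> {p<..<q}; t \<notin> E\<rbrakk> \<Longrightarrow> \<exists>y' a. (y has_real_derivative y') (at t) \<and>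
          (D has_real_derivative a) (at t) \<and> y' + a * y t \<le> a * \<kappa> (D t)"
    and G: "\<And>v. (G has_real_derivative \<kappa> v * exp v) (at v)"
    and \<kappa>: "continuous_on UNIV \<kappa>"
  shows "y q * exp (D q) - G (D q) \<le> y p * exp (D p) - G (D p)"
proof (rule abs_continuous_interval_nonincreasing[OF \<open>p \<le> q\<close> _ E])
  obtain M where M: "M-lipschitz_on {p..q} (\<lambda>t. exp (D t))"
    using lipschitz_on_C1_compose[OF D, of exp exp] DERIV_exp continuous_on_exp[OF continuous_on_id] by blast
  have "continuous_on UNIV (\<lambda>v. \<kappa> v * exp v)" by (intro continuous_intros \<kappa>)
  then obtain N where N: "N-lipschitz_on {p..q} (\<lambda>t. G (D t))"
    using lipschitz_on_C1_compose[OF D G] by blast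
  show "abs_continuous_interval (\<lambda>t. y t * exp (D t) - G (D t)) p q"
    using y M N
    by (intro abs_continuous_interval_diff abs_continuous_interval_mult)
       (auto intro: abs_continuous_interval_lipschitz)
  fix t assume "t \<in> {p<..<q}" "t \<notin> E"
  then obtain y' a where t: "(y has_real_derivative y') (at t)" "(D has_real_derivative a) (at t)"
    "y' + a * y t \<le> a * \<kappa> (D t)" using ineq by blast
  have "((\<lambda>t. y t * exp (D t) - G (D t)) has_real_derivative
      (y' * exp (D t) + (exp (D t) * a) * y t - \<kappa> (D t) * exp (D t) * a)) (at t)"
    by (intro DERIV_diff DERIV_mult t(1) DERIV_fun_exp t(2) DERIV_chain2[OF G t(2)])
  moreover have "y' * exp (D t) + (exp (D t) * a) * y t - \<kappa> (D t) * exp (D t) * a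
      = (y' + a * y t - a * \<kappa> (D t)) * exp (D t)" by (simp add: algebra_simps)
  moreover have "\<dots> \<le> 0" using t(3) by (simp add: mult_nonpos_nonneg)
  ultimately show "\<exists>d\<le>0. ((\<lambda>t. y t * exp (D t) - G (D t)) has_real_derivative d) (at t)" by metis
qed

text \<open>The clock time \<open>w\<close> solves \<open>B (exp (H - w) - 1) = 1\<close>: there the two bounds on the feedback after
  the last zero cross. The left-hand side below is the integral of
  \<open>B exp u min(1, B (exp (H - u) - 1))\<close> over \<open>[0, v]\<close> whenever \<open>0 \<le> w \<le> v \<le> H\<close>.\<close>

lemma barrier_inequality:
  fixes B H v w :: real
  assumes B: "B > 0"
    and cond: "1 / B * exp (- H) > ln ((B\<^sup>2 + B) / (B\<^sup>2 + 1))"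
    and w: "w = H - ln ((1 + B) / B)"
  shows "B * (exp w - 1 + B * (exp H * (v - w) - exp v + exp w)) < exp v"
proof -
  define c where "c = exp (- H) / B"
  have ew: "exp w * (1 + B) = B * exp H"
    using B by (simp add: w exp_diff field_simps)
  have cH: "B * exp H * c = 1" using B by (simp add: c_def exp_minus field_simps)
  have "exp (- c) < (B\<^sup>2 + 1) / (B\<^sup>2 + B)"
  proof -
    have pos: "(B\<^sup>2 + B) / (B\<^sup>2 + 1) > 0" using B by (intro divide_pos_pos) (auto simp: add_pos_pos)
    have "(B\<^sup>2 + B) / (B\<^sup>2 + 1) = exp (ln ((B\<^sup>2 + B) / (B\<^sup>2 + 1)))" using pos by simp
    also have "\<dots> < exp c" using cond by (simp add: c_def)
    finally have "inverse (exp c) < inverse ((B\<^sup>2 + B) / (B\<^sup>2 + 1))"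
      using pos by (rule less_imp_inverse_less)
    then show ?thesis by (simp add: exp_minus)
  qed
  then have lt: "(B\<^sup>2 + B) * exp (- c) < B\<^sup>2 + 1"
    using B by (simp add: pos_less_divide_eq add_pos_pos mult.commute)
  have "B * (exp w - 1 + B * (exp H * (v - w) - exp v + exp w))
      = B * (exp w * (1 + B)) - B + B\<^sup>2 * exp H * (v - w) - B\<^sup>2 * exp v"
    by (simp add: algebra_simps power2_eq_square)
  also have "\<dots> = B\<^sup>2 * exp H * (1 + (v - w - c)) - B\<^sup>2 * exp v"
    unfolding ew using cH by (simp add: algebra_simps power2_eq_square)
  \<comment> \<open>The tangent bound 1 + u \<le> exp u is an equality at \<open>v = w + c\<close>,
    the worst clock time, so maximising over \<open>v\<close> loses nothing. The logarithm in
    \<open>cond\<close> is exactly what this maximum requires.\<close>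
  also have "\<dots> \<le> B\<^sup>2 * exp H * exp (v - w - c) - B\<^sup>2 * exp v"
    using exp_ge_add_one_self[of "v - w - c"] by (intro diff_right_mono mult_left_mono) auto
  also have "B\<^sup>2 * exp H * exp (v - w - c) = (B\<^sup>2 + B) * exp (- c) * exp v"
  proof -
    have "B\<^sup>2 * exp H * exp (v - w - c) = B * (exp w * (1 + B)) * (exp v * exp (- w) * exp (- c))"
      unfolding ew by (simp add: exp_diff exp_minus exp_add power2_eq_square field_simps)
    also have "\<dots> = (exp w * exp (- w)) * ((B\<^sup>2 + B) * exp (- c) * exp v)"
      by (simp only: algebra_simps power2_eq_square)
    finally show ?thesis by (simp add: exp_minus)
  qed
  also have "\<dots> - B\<^sup>2 * exp v < (B\<^sup>2 + 1) * exp v - B\<^sup>2 * exp v"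
    using lt by (intro diff_strict_right_mono mult_strict_right_mono) auto
  finally show ?thesis by (simp add: algebra_simps)
qed

text \<open>The delayed terms are hidden in \<open>ineq\<close>: a lower bound \<open>- c\<close> of
  \<open>y\<close> on the window of clock length \<open>H\<close> limits the feedback to
  \<open>B * c\<close>. Only negative values in the window can therefore push \<open>y\<close> up,
  and the undershoot before the last zero is itself limited by \<open>Q\<close>.\<close>

lemma no_positive_record:
  fixes y D :: "real \<Rightarrow> real"
  assumes B: "B > 0" and H: "H \<ge> 0"
    and cond: "1 / B * exp (- H) > ln ((B\<^sup>2 + B) / (B\<^sup>2 + 1))"
    and lip: "L-lipschitz_on {0..\<tau>} D" and mono: "strict_mono_on {0..} D"
    and y: "abs_continuous_interval y 0 \<tau>"
    and E: "negligible E"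
    and ineq: "\<And>t. \<lbrakk>T1 < t; t \<notin> E\<rbrakk> \<Longrightarrow> \<exists>y' a. a \<ge> 0 \<and> (y has_real_derivative y') (at t) \<and>
        (D has_real_derivative a) (at t) \<and>
        (\<forall>c\<ge>0. (\<forall>s\<in>{0..t}. D t - D s \<le> H \<longrightarrow> - c \<le> y s) \<longrightarrow> y' + a * y t \<le> a * B * c)"
    and T: "0 \<le> T1" "T1 \<le> T3" "D T3 \<ge> D T1 + 2 * H" "T3 < \<tau>"
    and Q: "Q > 0" "y \<tau> = Q" "\<And>s. \<lbrakk>0 \<le> s; s < \<tau>\<rbrakk> \<Longrightarrow> \<bar>y s\<bar> < Q"
  shows False
proof -
  have cont_y: "continuous_on {0..\<tau>} y" by (rule abs_continuous_interval_imp_continuous_on[OF y])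
  have cont_D: "continuous_on {0..\<tau>} D" by (rule lipschitz_on_continuous_on[OF lip])
  have D_less: "D s < D t \<longleftrightarrow> s < t" if "0 \<le> s" "0 \<le> t" for s t
    using strict_mono_on_less[OF mono] that by simp
  have D_le: "D s \<le> D t \<longleftrightarrow> s \<le> t" if "0 \<le> s" "0 \<le> t" for s t
    using strict_mono_on_less_eq[OF mono] that by simp
  \<comment> \<open>\<open>\<kappa>\<close> may serve as feedback bound in clock time as soon as
    \<open>- \<kappa> (D t) / B\<close> is a lower bound of \<open>y\<close> on the window of
    \<open>t\<close>; this is \<open>ineq\<close> with \<open>c\<close> equal to
    \<open>\<kappa> (D t) / B\<close>.\<close>
  have cmp: "y q * exp (D q) - G (D q) \<le> y p * exp (D p) - G (D p)"
    if p: "T1 \<le> p" "p \<le> q" "q \<le> \<tau>"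
      and G: "\<And>v. (G has_real_derivative \<kappa> v * exp v) (at v)" "continuous_on UNIV \<kappa>"
      and low: "\<And>t. \<lbrakk>p < t; t < q\<rbrakk> \<Longrightarrow> 0 \<le> \<kappa> (D t)"
        "\<And>t s. \<lbrakk>p < t; t < q; 0 \<le> s; s \<le> t; D t - D s \<le> H\<rbrakk> \<Longrightarrow> - \<kappa> (D t) \<le> B * y s"
    for p q G \<kappa>
  proof (rule absolutely_continuous_comparison[OF p(2) _ _ E _ G])
    show "abs_continuous_interval y p q"
      using abs_continuous_interval_subset[OF y] p T by auto
    show "L-lipschitz_on {p..q} D"
      using lipschitz_on_subset[OF lip] p T by auto
    fix t assume t: "t \<in> {p<..<q}" "t \<notin> E"
    then obtain y' a where t': "(y has_real_derivative y') (at t)" "(D has_real_derivative a) (at t)"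
      "\<And>c. \<lbrakk>c \<ge> 0; \<forall>s\<in>{0..t}. D t - D s \<le> H \<longrightarrow> - c \<le> y s\<rbrakk> \<Longrightarrow> y' + a * y t \<le> a * B * c"
      using ineq[of t] p by fastforce
    have "y' + a * y t \<le> a * B * (\<kappa> (D t) / B)"
    proof (rule t'(3))
      show "\<kappa> (D t) / B \<ge> 0" using low(1) t B by simp
      show "\<forall>s\<in>{0..t}. D t - D s \<le> H \<longrightarrow> - (\<kappa> (D t) / B) \<le> y s"
        using low(2)[of t] t B by (auto simp: field_simps)
    qed
    then show "\<exists>y' a. (y has_real_derivative y') (at t) \<and>
          (D has_real_derivative a) (at t) \<and> y' + a * y t \<le> a * \<kappa> (D t)"
      using t' B by auto
  qed
  define Z where "Z = {s \<in> {0..\<tau>}. y s \<le> 0}"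
  have Zc: "compact Z"
  proof -
    have "closed ({0..\<tau>} \<inter> y -` {..0})"
      by (rule continuous_closed_preimage[OF cont_y]) auto
    moreover have "Z = {0..\<tau>} \<inter> ({0..\<tau>} \<inter> y -` {..0})" by (auto simp: Z_def)
    ultimately show ?thesis by (metis compact_Int_closed compact_Icc)
  qed
  show False
  proof (cases "\<exists>s\<in>Z. D \<tau> - D s \<le> H")
    case False
    \<comment> \<open>With no nonpositive value within one delay of \<open>\<tau>\<close>, the
      windows of all times shortly before \<open>\<tau>\<close> see only y \<ge> 0. There the
      feedback bound 0 is allowed, \<open>y t * exp (D t)\<close> cannot grow, and no record can
      arise.\<close>
    have "\<exists>c\<ge>T3. c < \<tau> \<and> (\<forall>t s. c < t \<and> t < \<tau> \<and> 0 \<le> s \<and> s \<le> t \<and> D t - D s \<le> H \<longrightarrow> 0 \<le> y s)"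
    proof (cases "Z = {}")
      case True
      then have "0 \<le> y s" if "0 \<le> s" "s \<le> \<tau>" for s using that by (force simp: Z_def)
      then show ?thesis using T by (intro exI[of _ T3]) auto
    next
      case nonempty: False
      then obtain \<sigma> where \<sigma>: "\<sigma> \<in> Z" "\<And>s. s \<in> Z \<Longrightarrow> s \<le> \<sigma>"
        using compact_attains_sup[OF Zc] by blast
      have \<sigma>H: "D \<sigma> + H < D \<tau>" using False \<sigma>(1) by force
      have \<sigma>0: "0 \<le> \<sigma>" "\<sigma> \<le> \<tau>" using \<sigma>(1) by (auto simp: Z_def)
      obtain c where c: "\<sigma> \<le> c" "c \<le> \<tau>" "D c = D \<sigma> + H"
        using IVT'[of D \<sigma> "D \<sigma> + H" \<tau>] \<sigma>H H \<sigma>0 continuous_on_subset[OF cont_D, of "{\<sigma>..\<tau>}"] by auto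
      have "c < \<tau>" using c \<sigma>H by (cases "c = \<tau>") auto
      have "0 \<le> y s" if "max c T3 < t" "t < \<tau>" "0 \<le> s" "s \<le> t" "D t - D s \<le> H" for s t
      proof -
        have "D c < D t" using D_less[of c t] that c \<sigma>0 by simp
        then have "D \<sigma> < D s" using that(5) c(3) by linarith
        then have "\<sigma> < s" using D_less[of \<sigma> s] that \<sigma>0 by simp
        then have "s \<notin> Z" using \<sigma>(2) by force
        then show ?thesis using that by (auto simp: Z_def)
      qed
      then show ?thesis using T \<open>c < \<tau>\<close> by (intro exI[of _ "max c T3"]) auto
    qed
    then obtain c where c: "T3 \<le> c" "c < \<tau>"
      "\<And>t s. \<lbrakk>c < t; t < \<tau>; 0 \<le> s; s \<le> t; D t - D s \<le> H\<rbrakk> \<Longrightarrow> 0 \<le> y s" by blast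
    have "Q * exp (D \<tau>) \<le> y c * exp (D c)"
      using cmp[of c \<tau> "\<lambda>_. 0" "\<lambda>_. 0"] c T B Q(2) by (auto simp: less_imp_le)
    also have "\<dots> < Q * exp (D c)" using Q(3)[of c] c T by (intro mult_strict_right_mono) auto
    also have "\<dots> \<le> Q * exp (D \<tau>)" using D_less[of c \<tau>] c T Q(1) by simp
    finally show False by simp
  next
    case True
    then obtain s0 where s0: "s0 \<in> Z" "D \<tau> - D s0 \<le> H" by blast
    then obtain \<sigma> where \<sigma>: "\<sigma> \<in> Z" "\<And>s. s \<in> Z \<Longrightarrow> s \<le> \<sigma>"
      using compact_attains_sup[OF Zc] by blast
    have \<sigma>0: "0 \<le> \<sigma>" "\<sigma> < \<tau>" using \<sigma>(1) Q(1,2) by (auto simp: Z_def less_le)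
    have \<sigma>H: "D \<tau> - D \<sigma> \<le> H"
      using s0 \<sigma>(2)[OF s0(1)] D_le[of s0 \<sigma>] \<sigma>0 by (auto simp: Z_def)
    have y\<sigma>: "y \<sigma> = 0"
    proof -
      obtain z where z: "\<sigma> \<le> z" "z \<le> \<tau>" "y z = 0"
        using IVT'[of y \<sigma> 0 \<tau>] \<sigma>(1) \<sigma>0 Q continuous_on_subset[OF cont_y, of "{\<sigma>..\<tau>}"]
        by (auto simp: Z_def)
      then have "z \<in> Z" using \<sigma>0 by (auto simp: Z_def)
      then show ?thesis using \<sigma>(2)[of z] z by simp
    qed
    have pos: "0 \<le> y s" if "\<sigma> \<le> s" "s \<le> \<tau>" for s
      using \<sigma>(2)[of s] that \<sigma>0 y\<sigma> by (cases "s = \<sigma>") (force simp: Z_def)+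
    \<comment> \<open>Of the two delays between \<open>T1\<close> and \<open>T3\<close>, one is
      spent on going back from \<open>\<tau>\<close> to \<open>\<sigma>\<close>; the other is left
      for the windows reaching behind \<open>\<sigma>\<close>.\<close>
    have D\<sigma>: "D T1 + H \<le> D \<sigma>" using D_less[of T3 \<tau>] T \<sigma>H by simp
    have T1\<sigma>: "T1 \<le> \<sigma>" using D_le[of T1 \<sigma>] D\<sigma> H T \<sigma>0 by simp
    \<comment> \<open>The constant feedback bound \<open>B * Q\<close> serves in both directions:
      started at \<open>\<sigma>\<close> it limits the growth (\<open>crude\<close>), and ended at
      \<open>\<sigma>\<close> it limits the undershoot (\<open>before\<close>).\<close>
    have U1: "(y q - B * Q) * exp (D q) \<le> (y p - B * Q) * exp (D p)"
      if "T1 \<le> p" "p \<le> q" "q \<le> \<tau>" for p q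
    proof -
      have "- (B * Q) \<le> B * y s" if "0 \<le> s" "s < \<tau>" for s
      proof -
        have "B * (- Q) \<le> B * y s" using Q(3)[OF that] B by (intro mult_left_mono) auto
        then show ?thesis by simp
      qed
      then have "y q * exp (D q) - B * Q * exp (D q) \<le> y p * exp (D p) - B * Q * exp (D p)"
        using that B Q(1)
        by (intro cmp[of p q "\<lambda>v. B * Q * exp v" "\<lambda>_. B * Q"]) (auto intro!: derivative_eq_intros)
      then show ?thesis by (simp add: algebra_simps)
    qed
    have crude: "y q * exp (D q) \<le> B * Q * (exp (D q) - exp (D \<sigma>))" if "\<sigma> \<le> q" "q \<le> \<tau>" for q
      using U1[OF T1\<sigma> that] y\<sigma> by (simp add: algebra_simps)
    have before: "- y r \<le> B * Q * (exp (D \<sigma> - D r) - 1)" if "T1 \<le> r" "r \<le> \<sigma>" for r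
    proof -
      have "(- B * Q) * exp (D \<sigma>) \<le> (y r - B * Q) * exp (D r)"
        using U1[of r \<sigma>] that \<sigma>0 y\<sigma> by simp
      then have "(- B * Q) * exp (D \<sigma>) / exp (D r) \<le> y r - B * Q"
        by (subst pos_divide_le_eq) simp_all
      then show ?thesis by (simp add: exp_diff algebra_simps)
    qed
    define w where "w = H - ln ((1 + B) / B)"
    note bar = barrier_inequality[OF B cond w_def]
    define v where "v = D \<tau> - D \<sigma>"
    have v: "v \<le> H" "0 < v" using \<sigma>H D_less[of \<sigma> \<tau>] \<sigma>0 by (auto simp: v_def)
    have ev: "exp (D \<tau>) = exp v * exp (D \<sigma>)" by (simp add: v_def exp_diff)
    have "Q * (exp v * exp (D \<sigma>)) \<le> Q * (B * (exp v - 1) * exp (D \<sigma>))"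
      using crude[of \<tau>] \<sigma>0 Q(2) unfolding ev by (simp add: algebra_simps)
    then have crude_v: "exp v \<le> B * (exp v - 1)" using Q(1) by simp
    \<comment> \<open>At clock time \<open>w\<close> after \<open>\<sigma>\<close> the undershoot
      bound takes over from \<open>B * Q\<close>. If \<open>w\<close> is not positive or not
      exceeded, \<open>crude_v\<close> alone is contradictory, in the second case by the barrier
      inequality at \<open>v = w\<close>. Both phases are needed only for
      \<open>0 < w < v\<close>.\<close>
    consider "w \<le> 0" | "0 < w" "v \<le> w" | "0 < w" "w < v" by linarith
    then show False
    proof cases
      case 1
      then have "exp H \<le> (1 + B) / B"
        using B by (metis w_def diff_le_0_iff_le exp_le_cancel_iff exp_ln add_pos_pos divide_pos_pos zero_less_one)
      moreover have "B * exp v \<le> B * exp H" using v B by simp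
      ultimately have "B * exp v \<le> 1 + B"
        using B by (simp only: pos_le_divide_eq mult.commute[of B])
      moreover have "exp v \<le> B * exp v - B" using crude_v by (simp add: algebra_simps)
      ultimately have "exp v \<le> 1" by linarith
      then show False using v by simp
    next
      case 2
      have "(B - 1) * exp v \<ge> B" using crude_v by (simp add: algebra_simps)
      moreover have "B > 1"
      proof (rule ccontr)
        assume "\<not> 1 < B"
        then have "(B - 1) * exp v \<le> 0" by (intro mult_nonpos_nonneg) auto
        then show False using calculation B by simp
      qed
      moreover have "(B - 1) * exp v \<le> (B - 1) * exp w" using 2 \<open>B > 1\<close> by simp
      moreover have "(B - 1) * exp w < B" using bar[of w] by (simp add: algebra_simps)
      ultimately show False by linarith
    next
      case 3
      obtain c where c: "\<sigma> \<le> c" "c \<le> \<tau>" "D c = D \<sigma> + w"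
        using IVT'[of D \<sigma> "D \<sigma> + w" \<tau>] 3 \<sigma>0 continuous_on_subset[OF cont_D, of "{\<sigma>..\<tau>}"]
        by (auto simp: v_def)
      \<comment> \<open>The window of \<open>t\<close> reaches back at most to the clock value
        \<open>D t - H\<close>, and \<open>before\<close> bounds the undershoot by its value there.
        \<open>G\<close> is the primitive of \<open>\<kappa> u * exp u\<close>.\<close>
      define \<kappa> where "\<kappa> u = B * (B * Q * (exp (H + D \<sigma> - u) - 1))" for u
      define G where "G u = B\<^sup>2 * Q * (exp (H + D \<sigma>) * u - exp u)" for u
      have "y \<tau> * exp (D \<tau>) - G (D \<tau>) \<le> y c * exp (D c) - G (D c)"
      proof (rule cmp[where \<kappa> = \<kappa>])
        show "T1 \<le> c" "c \<le> \<tau>" "\<tau> \<le> \<tau>" using c T1\<sigma> by auto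
        show "(G has_real_derivative \<kappa> u * exp u) (at u)" for u
          unfolding G_def[abs_def] \<kappa>_def
          by (auto intro!: derivative_eq_intros simp: exp_diff power2_eq_square field_simps)
        show "continuous_on UNIV \<kappa>" unfolding \<kappa>_def by (intro continuous_intros)
        fix t assume t: "c < t" "t < \<tau>"
        have "D t < D \<tau>" using D_less[of t \<tau>] t c \<sigma>0 by simp
        then have "0 \<le> H + D \<sigma> - D t" using \<sigma>H by simp
        then show \<kappa>0: "0 \<le> \<kappa> (D t)" using B Q by (simp add: \<kappa>_def)
        fix s assume s: "0 \<le> s" "s \<le> t" "D t - D s \<le> H"
        show "- \<kappa> (D t) \<le> B * y s"
        proof (cases "\<sigma> \<le> s")
          case True
          then have "0 \<le> B * y s" using pos[of s] s t B by simp
          then show ?thesis using \<kappa>0 by simp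
        next
          case False
          have "D \<sigma> < D t" using D_less[of \<sigma> t] t c \<sigma>0 by simp
          then have "D T1 \<le> D s" using s D\<sigma> by simp
          then have "T1 \<le> s" using D_le[of T1 s] T s by simp
          then have "- y s \<le> B * Q * (exp (D \<sigma> - D s) - 1)" using before[of s] False by simp
          also have "\<dots> \<le> B * Q * (exp (H + D \<sigma> - D t) - 1)"
            using s B Q by (intro mult_left_mono) auto
          finally have "B * (- y s) \<le> \<kappa> (D t)"
            unfolding \<kappa>_def using B by (intro mult_left_mono) auto
          then show ?thesis by simp
        qed
      qed
      also have "\<dots> \<le> B * Q * (exp (D c) - exp (D \<sigma>)) - G (D c)"
        using crude[of c] c by simp
      finally have "(Q * exp (D \<sigma>)) * exp v \<le> (Q * exp (D \<sigma>)) * (B * (exp w - 1 + B * (exp H * (v - w) - exp v + exp w)))"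
        unfolding G_def c(3) ev Q(2) exp_add
        by (simp add: v_def algebra_simps power2_eq_square ev[unfolded v_def])
      then have "exp v \<le> B * (exp w - 1 + B * (exp H * (v - w) - exp v + exp w))"
        using Q(1) by (simp add: mult_le_cancel_left_pos)
      then show False using bar[of v] by simp
    qed
  qed
qed

lemma abs_continuous_interval_uminus:
  assumes "abs_continuous_interval f p q"
  shows "abs_continuous_interval (\<lambda>t. - f t) p q"
  by (rule abs_continuous_interval_dominated[OF assms assms, of _ 1]) (auto simp: abs_minus_commute)

lemma first_exceedance:
  fixes f z :: "real \<Rightarrow> real"
  assumes "continuous_on {0..t} f" "continuous_on {0..t} z" "0 \<le> t" "z t \<le> f t"
  obtains \<tau> where "0 \<le> \<tau>" "\<tau> \<le> t" "z \<tau> \<le> f \<tau>" "\<And>s. \<lbrakk>0 \<le> s; s < \<tau>\<rbrakk> \<Longrightarrow> f s < z s"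
proof -
  define S where "S = {0..t} \<inter> (\<lambda>s. f s - z s) -` {0..}"
  have "closed S"
    unfolding S_def by (intro continuous_closed_preimage continuous_on_diff assms) auto
  then have "compact ({0..t} \<inter> S)" by (metis compact_Int_closed compact_Icc)
  moreover have "{0..t} \<inter> S = S" by (auto simp: S_def)
  moreover have "t \<in> S" using assms by (auto simp: S_def)
  ultimately obtain \<tau> where "\<tau> \<in> S" "\<And>s. s \<in> S \<Longrightarrow> \<tau> \<le> s"
    using compact_attains_inf[of S] by auto
  then show ?thesis by (intro that[of \<tau>]) (force simp: S_def)+
qed

text \<open>The two-sided inequality is invariant under y \<mapsto> -y, so a record of the absolute
  value is a positive record of \<open>y\<close> or of \<open>- y\<close>.\<close>

lemma bounded_by_history:
  fixes y D :: "real \<Rightarrow> real"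
  assumes B: "B > 0" and H: "H \<ge> 0"
    and cond: "1 / B * exp (- H) > ln ((B\<^sup>2 + B) / (B\<^sup>2 + 1))"
    and lip: "\<And>T. L-lipschitz_on {0..T} D" and mono: "strict_mono_on {0..} D"
    and y: "\<And>T. T \<ge> 0 \<Longrightarrow> abs_continuous_interval y 0 T"
    and E: "negligible E"
    and ineq: "\<And>t. \<lbrakk>T1 < t; t \<notin> E\<rbrakk> \<Longrightarrow> \<exists>y' a. a \<ge> 0 \<and> (y has_real_derivative y') (at t) \<and>
        (D has_real_derivative a) (at t) \<and>
        (\<forall>c\<ge>0. (\<forall>s\<in>{0..t}. D t - D s \<le> H \<longrightarrow> - c \<le> y s) \<longrightarrow> y' + a * y t \<le> a * B * c) \<and>
        (\<forall>c\<ge>0. (\<forall>s\<in>{0..t}. D t - D s \<le> H \<longrightarrow> y s \<le> c) \<longrightarrow> - (a * B * c) \<le> y' + a * y t)"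
    and T: "0 \<le> T1" "T1 \<le> T3" "D T3 \<ge> D T1 + 2 * H"
    and P: "\<And>t. \<lbrakk>0 \<le> t; t \<le> T3\<rbrakk> \<Longrightarrow> \<bar>y t\<bar> \<le> P"
    and t: "t \<ge> 0"
  shows "\<bar>y t\<bar> \<le> P"
proof (rule ccontr)
  assume "\<not> \<bar>y t\<bar> \<le> P"
  then have gt: "P < \<bar>y t\<bar>" by simp
  have cont: "continuous_on {0..t} (\<lambda>s. \<bar>y s\<bar>)"
    by (intro continuous_on_rabs abs_continuous_interval_imp_continuous_on y t)
  \<comment> \<open>Taking the first time at which the level \<open>\<bar>y t\<bar>\<close> is
    reached makes the record strict against all earlier times.\<close>
  obtain \<tau> where \<tau>: "0 \<le> \<tau>" "\<tau> \<le> t" "\<bar>y t\<bar> \<le> \<bar>y \<tau>\<bar>" "\<And>s. \<lbrakk>0 \<le> s; s < \<tau>\<rbrakk> \<Longrightarrow> \<bar>y s\<bar> < \<bar>y t\<bar>"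
    using first_exceedance[OF cont continuous_on_const t, of "\<bar>y t\<bar>"] by auto
  have T3: "T3 < \<tau>" using P[of \<tau>] \<tau> gt by force
  have pos: "\<bar>y \<tau>\<bar> > 0" using P[of 0] T \<tau>(3) gt by auto
  have less: "\<bar>y s\<bar> < \<bar>y \<tau>\<bar>" if "0 \<le> s" "s < \<tau>" for s using \<tau>(3) \<tau>(4)[OF that] by simp
  show False
  proof (cases "y \<tau> > 0")
    case True
    show ?thesis
    proof (rule no_positive_record[OF B H cond lip mono y[OF \<tau>(1)] E _ T T3 pos])
      show "\<exists>y' a. a \<ge> 0 \<and> (y has_real_derivative y') (at t) \<and> (D has_real_derivative a) (at t) \<and>
        (\<forall>c\<ge>0. (\<forall>s\<in>{0..t}. D t - D s \<le> H \<longrightarrow> - c \<le> y s) \<longrightarrow> y' + a * y t \<le> a * B * c)"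
        if "T1 < t" "t \<notin> E" for t using ineq[OF that] by blast
    qed (use True less in auto)
  next
    case False
    show ?thesis
    proof (rule no_positive_record[OF B H cond lip mono abs_continuous_interval_uminus[OF y[OF \<tau>(1)]] E _ T T3 pos])
      fix t assume "T1 < t" "t \<notin> E"
      then obtain y' a where *: "a \<ge> 0" "(y has_real_derivative y') (at t)" "(D has_real_derivative a) (at t)"
        "\<And>c. \<lbrakk>c\<ge>0; \<forall>s\<in>{0..t}. D t - D s \<le> H \<longrightarrow> y s \<le> c\<rbrakk> \<Longrightarrow> - (a * B * c) \<le> y' + a * y t"
        using ineq[of t] by blast
      have "- y' + a * - y t \<le> a * B * c" if "c \<ge> 0" "\<forall>s\<in>{0..t}. D t - D s \<le> H \<longrightarrow> - c \<le> - y s" for c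
        using *(4)[of c] that by simp
      then show "\<exists>y' a. a \<ge> 0 \<and> ((\<lambda>t. - y t) has_real_derivative y') (at t) \<and> (D has_real_derivative a) (at t) \<and>
        (\<forall>c\<ge>0. (\<forall>s\<in>{0..t}. D t - D s \<le> H \<longrightarrow> - c \<le> - y s) \<longrightarrow> y' + a * - y t \<le> a * B * c)"
        using *(1-3) DERIV_minus by blast
    qed (use False less in auto)
  qed
qed

subsection \<open>Growth of solutions and Stieltjes averages\<close>

text \<open>A Gronwall argument with unbounded memory. The barrier \<open>z\<close> increases, so
  before the first contact it dominates the whole past of \<open>x\<close>, and \<open>x\<close>
  cannot grow faster than \<open>z\<close>. Starting \<open>z\<close> at some \<open>K'\<close>
  strictly above \<open>K\<close> excludes contact.\<close>

lemma exponential_growth_bound: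
  fixes x :: "real \<Rightarrow> real"
  assumes x: "\<And>T. T \<ge> 0 \<Longrightarrow> abs_continuous_interval x 0 T"
    and init: "\<And>t. t \<le> 0 \<Longrightarrow> \<bar>x t\<bar> \<le> K" and L: "L \<ge> 0"
    and E: "negligible E"
    and der: "\<And>t. \<lbrakk>0 < t; t \<notin> E\<rbrakk> \<Longrightarrow> \<exists>x'. (x has_real_derivative x') (at t) \<and>
        (\<forall>C. (\<forall>s\<le>t. \<bar>x s\<bar> \<le> C) \<longrightarrow> \<bar>x'\<bar> \<le> L * C)"
    and t: "t \<ge> 0"
  shows "\<bar>x t\<bar> \<le> K * exp (L * t)"
proof (rule ccontr)
  assume "\<not> ?thesis"
  then have gt: "K < \<bar>x t\<bar> * exp (- (L * t))" by (simp add: exp_minus field_simps)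
  then obtain K' where K': "K < K'" "K' < \<bar>x t\<bar> * exp (- (L * t))" using dense by blast
  have K0: "0 \<le> K" using init[of 0] by simp
  define z where "z t = K' * exp (L * t)" for t
  have z_mono: "z u \<le> z v" if "u \<le> v" for u v
    using that K0 K' L by (auto simp: z_def intro!: mult_left_mono)
  have z_der: "(z has_real_derivative L * z t) (at t)" for t
    unfolding z_def[abs_def] by (auto intro!: derivative_eq_intros)
  have cont: "continuous_on {0..t} (\<lambda>s. \<bar>x s\<bar>)"
    by (intro continuous_on_rabs abs_continuous_interval_imp_continuous_on x t)
  have contz: "continuous_on A z" for A
    unfolding z_def by (intro continuous_intros)
  have "z t \<le> \<bar>x t\<bar>" using K' by (simp add: z_def exp_minus field_simps)
  then obtain \<tau> where \<tau>: "0 \<le> \<tau>" "\<tau> \<le> t" "z \<tau> \<le> \<bar>x \<tau>\<bar>" "\<And>s. \<lbrakk>0 \<le> s; s < \<tau>\<rbrakk> \<Longrightarrow> \<bar>x s\<bar> < z s"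
    using first_exceedance[OF cont contz t] by blast
  obtain N where N: "N-lipschitz_on {0..\<tau>} z"
  proof -
    have "1-lipschitz_on {0..\<tau>} (\<lambda>t::real. t)" by (rule lipschitz_onI) auto
    moreover have "continuous_on UNIV (\<lambda>v. L * z v)" by (intro continuous_intros contz)
    ultimately show ?thesis using lipschitz_on_C1_compose[OF _ z_der] that by blast
  qed
  have main: "\<sigma> * x \<tau> < z \<tau>" if \<sigma>: "\<sigma> = 1 \<or> \<sigma> = -1" for \<sigma> :: real
  proof -
    have "\<sigma> * x \<tau> - z \<tau> \<le> \<sigma> * x 0 - z 0"
    proof (rule abs_continuous_interval_nonincreasing[OF \<tau>(1) _ E])
      have "abs_continuous_interval (\<lambda>t. \<sigma> * x t) 0 \<tau>"
        using \<sigma> x[OF \<tau>(1)] abs_continuous_interval_uminus[OF x[OF \<tau>(1)]] by auto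
      then show "abs_continuous_interval (\<lambda>t. \<sigma> * x t - z t) 0 \<tau>"
        by (intro abs_continuous_interval_diff abs_continuous_interval_lipschitz[OF N])
      fix u assume u: "u \<in> {0<..<\<tau>}" "u \<notin> E"
      then obtain x' where x': "(x has_real_derivative x') (at u)"
        "\<And>C. \<forall>s\<le>u. \<bar>x s\<bar> \<le> C \<Longrightarrow> \<bar>x'\<bar> \<le> L * C" using der[of u] by auto
      have "\<bar>x s\<bar> \<le> z u" if "s \<le> u" for s
      proof (cases "s \<le> 0")
        case True
        have "\<bar>x s\<bar> \<le> z 0" using init[OF True] K' by (simp add: z_def)
        also have "\<dots> \<le> z u" using u by (intro z_mono) auto
        finally show ?thesis .
      next
        case False
        then show ?thesis using \<tau>(4)[of s] z_mono[OF that] u that by simp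
      qed
      then have "\<bar>x'\<bar> \<le> L * z u" using x'(2) by blast
      then have "\<sigma> * x' - L * z u \<le> 0" using \<sigma> by auto
      moreover have "((\<lambda>t. \<sigma> * x t - z t) has_real_derivative \<sigma> * x' - L * z u) (at u)"
        by (intro DERIV_diff DERIV_cmult x' z_der)
      ultimately show "\<exists>d\<le>0. ((\<lambda>t. \<sigma> * x t - z t) has_real_derivative d) (at u)" by blast
    qed
    moreover have "\<sigma> * x 0 < z 0" using init[of 0] K' \<sigma> by (auto simp: z_def)
    ultimately show ?thesis by simp
  qed
  from main[of 1] main[of "-1"] \<tau>(3) show False by auto
qed

text \<open>The integrator gives the interval mass one, so the integral is an average. Keeping the
  two bounds apart matters because the record argument uses only one side at a time.\<close>

lemma stieltjes_integral_one_sided_bounds: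
  fixes x :: "real \<Rightarrow> real"
  assumes one: "stieltjes_integral F p q (\<lambda>_. 1) = 1" and x: "continuous_on UNIV x"
  shows "(\<And>s. \<lbrakk>p \<le> s; s \<le> q\<rbrakk> \<Longrightarrow> c \<le> x s) \<Longrightarrow> c \<le> stieltjes_integral F p q x"
    and "(\<And>s. \<lbrakk>p \<le> s; s \<le> q\<rbrakk> \<Longrightarrow> x s \<le> c) \<Longrightarrow> stieltjes_integral F p q x \<le> c"
proof -
  define M where "M = interval_measure (\<lambda>u. Lim (at_right u) F)"
  have M: "sets M = sets borel" "space M = UNIV" by (simp_all add: M_def)
  have A: "{p..q} \<in> sets M" by (simp add: M)
  have "measure M {p..q} = 1"
    using one A by (simp add: stieltjes_integral_def set_lebesgue_integral_def M_def[symmetric] M)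
  \<comment> \<open>\<open>measure\<close> returns 0 on sets of infinite mass, so the value 1
    certifies finiteness.\<close>
  then have fin: "emeasure M {p..q} < \<infinity>"
    by (metis emeasure_eq_ennreal_measure ennreal_less_top infinity_ennreal_def measure_zero_top one_neq_zero zero_neq_one)
  have const: "set_integrable M {p..q} (\<lambda>_. c)" "(LINT s:{p..q}|M. c) = c" for c :: real
    using A fin \<open>measure M {p..q} = 1\<close>
    by (auto simp: set_integrable_def set_lebesgue_integral_def M)
  have "bounded (x ` {p..q})"
    by (intro compact_imp_bounded compact_continuous_image continuous_on_subset[OF x]) auto
  then obtain K where K: "\<forall>v\<in>x ` {p..q}. norm v \<le> K" using bounded_iff by blast
  have "x \<in> borel_measurable M"
    using borel_measurable_continuous_onI[OF x] M by (metis measurable_cong_sets)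
  moreover have "\<bar>x s\<bar> \<le> \<bar>K\<bar>" if "p \<le> s" "s \<le> q" for s using K that by force
  ultimately have int: "set_integrable M {p..q} x"
    using A by (intro set_integrable_bound[OF const(1)[of K]]) (auto simp: set_borel_measurable_def)
  have eq: "stieltjes_integral F p q x = (LINT s:{p..q}|M. x s)"
    by (simp add: stieltjes_integral_def M_def)
  show "c \<le> stieltjes_integral F p q x" if "\<And>s. \<lbrakk>p \<le> s; s \<le> q\<rbrakk> \<Longrightarrow> c \<le> x s"
    using set_integral_mono[OF const(1)[of c] int] that const(2)[of c] by (simp add: eq)
  show "stieltjes_integral F p q x \<le> c" if "\<And>s. \<lbrakk>p \<le> s; s \<le> q\<rbrakk> \<Longrightarrow> x s \<le> c"
    using set_integral_mono[OF int const(1)[of c]] that const(2)[of c] by (simp add: eq)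
qed

subsection \<open>The clock and the choice of constants\<close>

lemma AE_lebesgue_on_nonneg_obtain:
  assumes "AE t in lebesgue_on {0::real..}. P t"
  obtains E where "negligible E" "\<And>t. \<lbrakk>0 \<le> t; t \<notin> E\<rbrakk> \<Longrightarrow> P t"
proof -
  have "AE t in lebesgue. t \<in> {0..} \<longrightarrow> P t"
    using assms by (subst (asm) AE_restrict_space_iff) auto
  then obtain N where "negligible N" "{t. \<not> (t \<in> {0..} \<longrightarrow> P t)} \<subseteq> N"
    unfolding eventually_ae_filter_negligible by auto
  then show ?thesis using that by auto
qed

text \<open>Since \<open>a\<close> is bounded only almost everywhere, \<open>A\<close> integrates
  its truncation at \<open>max C a0\<close>. This changes \<open>a\<close> on a null set, keeps the
  lower bound \<open>a0\<close> and makes \<open>A\<close> Lipschitz. \<open>A\<close> is a gauge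
  integral; the last conclusion links it to the Lebesgue integral that defines
  \<open>h0\<close>.\<close>

lemma integral_clock:
  fixes a :: "real \<Rightarrow> real"
  assumes meas: "a \<in> borel_measurable (lebesgue_on {0..})"
    and bdd: "AE t in lebesgue_on {0..}. a t \<le> C"
    and low: "\<And>t. t \<ge> 0 \<Longrightarrow> a0 \<le> a t" and a0: "a0 > 0"
  obtains A L E where "\<And>T. L-lipschitz_on {0..T} A" "A 0 = 0" "negligible E"
    "\<And>t. \<lbrakk>t > 0; t \<notin> E\<rbrakk> \<Longrightarrow> (A has_real_derivative a t) (at t)"
    "\<And>u v. \<lbrakk>0 \<le> u; u \<le> v\<rbrakk> \<Longrightarrow> a0 * (v - u) \<le> A v - A u"
    "\<And>u v. \<lbrakk>0 \<le> u; u \<le> v\<rbrakk> \<Longrightarrow> (LINT s:{u..v}|lebesgue. a s) = A v - A u"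
proof -
  obtain N where N: "negligible N" "\<And>t. \<lbrakk>0 \<le> t; t \<notin> N\<rbrakk> \<Longrightarrow> a t \<le> C"
    using AE_lebesgue_on_nonneg_obtain[OF bdd] by blast
  define C' where "C' = max C a0"
  have C': "0 < C'" "a0 \<le> C'" using a0 by (auto simp: C'_def)
  define f where "f = (\<lambda>t. min (a t) C')"
  have f_eq: "f t = a t" if "0 \<le> t" "t \<notin> N" for t
    using N(2)[OF that] by (simp add: f_def C'_def)
  have f_bounds: "a0 \<le> f t" "f t \<le> C'" if "0 \<le> t" for t
    using low[OF that] C' by (auto simp: f_def)
  have f_abs: "f absolutely_integrable_on {u..v}" if "0 \<le> u" for u v
  proof (rule measurable_bounded_by_integrable_imp_absolutely_integrable)
    have "f \<in> borel_measurable (lebesgue_on {0..})"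
      unfolding f_def by (intro borel_measurable_min meas) auto
    then show "f \<in> borel_measurable (lebesgue_on {u..v})"
      by (rule measurable_restrict_mono) (use that in auto)
    show "norm (f t) \<le> C'" if "t \<in> {u..v}" for t
      using f_bounds[of t] that \<open>0 \<le> u\<close> a0 by auto
  qed auto
  then have f_int: "f integrable_on {u..v}" if "0 \<le> u" for u v
    using that set_lebesgue_integral_eq_integral(1) by blast
  define A where "A t = integral {0..t} f" for t
  have A_diff: "A v - A u = integral {u..v} f" if "0 \<le> u" "u \<le> v" for u v
    using Henstock_Kurzweil_Integration.integral_combine[OF that f_int[of 0]] by (simp add: A_def)
  have A_bounds: "a0 * (v - u) \<le> A v - A u" "A v - A u \<le> C' * (v - u)" if "0 \<le> u" "u \<le> v" for u v
  proof -
    have "integral {u..v} (\<lambda>_. a0) \<le> integral {u..v} f"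
      using that f_bounds by (intro integral_le f_int) auto
    then show "a0 * (v - u) \<le> A v - A u" using A_diff[OF that] that by (simp add: mult.commute)
    have "integral {u..v} f \<le> integral {u..v} (\<lambda>_. C')"
      using that f_bounds by (intro integral_le f_int) auto
    then show "A v - A u \<le> C' * (v - u)" using A_diff[OF that] that by (simp add: mult.commute)
  qed
  \<comment> \<open>The differentiation lemma concerns bounded intervals, hence the countable
    union.\<close>
  define E where "E = N \<union> (\<Union>n. {t \<in> {0<..<real n}. \<not> (A has_real_derivative f t) (at t)})"
  show ?thesis
  proof (rule that[of C' A E])
    show "C'-lipschitz_on {0..T} A" for T
    proof (rule lipschitz_onI)
      have *: "dist (A u) (A v) \<le> C' * dist u v" if "0 \<le> u" "u \<le> v" for u v
      proof -
        have "0 \<le> a0 * (v - u)" using a0 that by simp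
        then show ?thesis using A_bounds[OF that] that by (simp add: dist_real_def)
      qed
      then show "dist (A u) (A v) \<le> C' * dist u v" if "u \<in> {0..T}" "v \<in> {0..T}" for u v
        using that *[of u v] *[of v u] by (cases "u \<le> v") (auto simp: dist_commute[of "A u"] dist_commute[of u])
    qed (use C' in simp)
    show "A 0 = 0" by (simp add: A_def)
    show "negligible E"
      unfolding E_def A_def
      by (intro negligible_Un N negligible_Union_nat negligible_not_differentiable_integral f_int) auto
    show "(A has_real_derivative a t) (at t)" if t: "t > 0" "t \<notin> E" for t
    proof -
      obtain n where "t < real n" using reals_Archimedean2 by blast
      then have "(A has_real_derivative f t) (at t)" using t by (auto simp: E_def)
      then show ?thesis using f_eq t by (simp add: E_def)
    qed
    show "(LINT s:{u..v}|lebesgue. a s) = A v - A u" if "0 \<le> u" "u \<le> v" for u v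
    proof -
      have "a absolutely_integrable_on {u..v}"
        by (rule absolutely_integrable_spike[OF f_abs[OF that(1)] N(1)]) (use f_eq that in auto)
      then have "(LINT s:{u..v}|lebesgue. a s) = integral {u..v} a"
        by (rule set_lebesgue_integral_eq_integral)
      also have "\<dots> = integral {u..v} f"
        by (rule integral_spike[OF N(1)]) (use f_eq that in auto)
      finally show ?thesis using A_diff[OF that] by simp
    qed
  qed (use A_bounds in auto)
qed

text \<open>Both parameters are raised by the same small amount, so continuity in one variable
  suffices. As \<open>1 / 0 = 0\<close>, the case \<beta> = 0 stands apart: there
  \<open>B = 1\<close> makes the logarithm vanish, and any \<open>H\<close> will do.\<close>

lemma threshold_perturbation:
  fixes \<beta> h0 :: real
  assumes "\<beta> \<ge> 0"
    and "\<beta> = 0 \<or> 1 / \<beta> * exp (- h0) > ln ((\<beta>\<^sup>2 + \<beta>) / (\<beta>\<^sup>2 + 1))"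
  obtains B H where "\<beta> < B" "h0 < H" "1 / B * exp (- H) > ln ((B\<^sup>2 + B) / (B\<^sup>2 + 1))"
proof (cases "\<beta> = 0")
  case True
  then show ?thesis using that[of 1 "h0 + 1"] by simp
next
  case False
  then have \<beta>: "\<beta> > 0" using assms by simp
  define g where "g d = 1 / (\<beta> + d) * exp (- (h0 + d)) - ln (((\<beta> + d)\<^sup>2 + (\<beta> + d)) / ((\<beta> + d)\<^sup>2 + 1))" for d
  have "isCont g 0"
    unfolding g_def using \<beta> by (intro continuous_intros) (auto simp: add_nonneg_eq_0_iff add_pos_pos)
  then have "(g \<longlongrightarrow> g 0) (at_right 0)"
    unfolding isCont_def using filterlim_at_split by blast
  moreover have "g 0 > 0" using assms False by (simp add: g_def)
  ultimately have "eventually (\<lambda>d. g d > 0) (at_right 0)" by (rule order_tendstoD)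
  then obtain d where "d > 0" "g d > 0"
    unfolding eventually_at_right_field by (metis dense)
  then show ?thesis using that[of "\<beta> + d" "h0 + d"] by (simp add: g_def)
qed

text \<open>At \<epsilon> = 0 the inequality is strict, so it persists for small \<epsilon>. The two
  sides are the prices of the weight exp(\<epsilon> A): inflated feedback and a slower
  clock.\<close>

lemma discount_rate:
  fixes B \<beta> H :: real
  assumes "\<beta> < B"
  obtains \<epsilon> where "0 < \<epsilon>" "\<epsilon> < 1" "\<beta> * exp (\<epsilon> * H) \<le> (1 - \<epsilon>) * B"
proof -
  define g where "g e = (1 - e) * B - \<beta> * exp (e * H)" for e
  have "isCont g 0" unfolding g_def by (intro continuous_intros)
  then have "(g \<longlongrightarrow> g 0) (at_right 0)"
    unfolding isCont_def using filterlim_at_split by blast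
  moreover have "g 0 > 0" using assms by (simp add: g_def)
  ultimately have "eventually (\<lambda>e. g e > 0) (at_right 0)" by (rule order_tendstoD)
  then obtain d where d: "d > 0" "\<And>e. \<lbrakk>0 < e; e < d\<rbrakk> \<Longrightarrow> g e > 0"
    unfolding eventually_at_right_field by auto
  have "g (min d 1 / 2) > 0" using d by (intro d(2)) auto
  then show ?thesis using that[of "min d 1 / 2"] d(1) by (simp add: g_def)
qed

subsection \<open>Decay of solutions\<close>

lemma initial_norm_ge:
  assumes "admissible_initial \<phi>" "t \<le> 0"
  shows "\<bar>\<phi> t\<bar> \<le> initial_norm \<phi>"
proof -
  obtain C where "\<forall>v\<in>\<phi> ` {..0}. norm v \<le> C"
    using assms(1) unfolding admissible_initial_def bounded_iff by blast
  then have "bdd_above ((\<lambda>s. \<bar>\<phi> s\<bar>) ` {..0})" by (intro bdd_aboveI2[of _ _ C]) auto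
  then show ?thesis unfolding initial_norm_def by (intro cSUP_upper) (use assms in auto)
qed

lemma solution_continuous:
  assumes "admissible_initial \<phi>" "is_solution m a b h R \<phi> x"
  shows "continuous_on UNIV x"
proof -
  have "continuous_on {..0} x"
    using assms unfolding admissible_initial_def is_solution_def
    by (metis (mono_tags) atMost_iff continuous_on_cong)
  moreover have "continuous_on {0..} x"
    unfolding continuous_on_eq_continuous_within
  proof
    fix t :: real assume "t \<in> {0..}"
    then have "continuous_on {0..t+1} x"
      using assms(2) unfolding is_solution_def by (intro abs_continuous_interval_imp_continuous_on) auto
    then have "continuous (at t within {0..t+1}) x"
      using \<open>t \<in> {0..}\<close> by (auto simp: continuous_on_eq_continuous_within)
    moreover have "at t within {0..} = at t within {0..t+1}"
      by (rule at_within_nhd[of t "{..<t+1}"]) auto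
    ultimately show "continuous (at t within {0..}) x" by simp
  qed
  ultimately have "continuous_on ({..0} \<union> {0..}) x"
    by (intro continuous_on_closed_Un) auto
  then show ?thesis by (metis UNIV_I Un_iff atLeast_iff atMost_iff linear subset_UNIV subset_antisym subsetI)
qed

theorem theorem4:
  fixes m :: nat
    and a :: "real \<Rightarrow> real"
    and b h :: "nat \<Rightarrow> real \<Rightarrow> real"
    and R :: "nat \<Rightarrow> real \<Rightarrow> real \<Rightarrow> real"
    and a0 h0 \<beta> :: real
  assumes "m \<ge> 1"
    and "a \<in> borel_measurable (lebesgue_on {0..})"
    and "\<exists>C. AE t in lebesgue_on {0..}. a t \<le> C"
    and "\<And>k. k \<in> {1..m} \<Longrightarrow> b k \<in> borel_measurable (lebesgue_on {0..})"
    and "\<And>k. k \<in> {1..m} \<Longrightarrow> \<exists>C. AE t in lebesgue_on {0..}. b k t \<le> C"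
    and "\<And>k t. k \<in> {1..m} \<Longrightarrow> t \<ge> 0 \<Longrightarrow> b k t \<ge> 0"
    and "\<And>k. k \<in> {1..m} \<Longrightarrow> h k \<in> borel_measurable (lebesgue_on {0..})"
    and "\<And>k t. k \<in> {1..m} \<Longrightarrow> t \<ge> 0 \<Longrightarrow> h k t \<le> t"
    and "\<And>k. k \<in> {1..m} \<Longrightarrow> filterlim (h k) at_top at_top"
    and "\<And>k. k \<in> {1..m} \<Longrightarrow> AE t in lebesgue_on {0..}. mono (R k t)"
    and "\<And>k. k \<in> {1..m} \<Longrightarrow>
           AE t in lebesgue_on {0..}. stieltjes_integral (R k t) (h k t) t (\<lambda>_. 1) = 1"
    and "a0 > 0"
    and "\<And>t. t \<ge> 0 \<Longrightarrow> a t \<ge> a0"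
    and "ereal h0 =
           Limsup at_top (\<lambda>t. ereal (LINT s:{(MIN k\<in>{1..m}. h k t)..t}|lebesgue. a s))"
    and "ereal \<beta> = Limsup at_top (\<lambda>t. ereal ((\<Sum>k=1..m. b k t) / a t))"
    and "\<beta> = 0 \<or> 1 / \<beta> * exp (- h0) > ln ((\<beta>\<^sup>2 + \<beta>) / (\<beta>\<^sup>2 + 1))"
  shows "exponentially_stable m a b h R"
proof -
  note m = assms(1) and b_nonneg = assms(6) and h_le = assms(8) and a0 = assms(12)
    and a_ge = assms(13)
  define hmin where "hmin t = (MIN k\<in>{1..m}. h k t)" for t
  define bs where "bs t = (\<Sum>k=1..m. b k t)" for t
  have bs_nonneg: "0 \<le> bs t" if "0 \<le> t" for t
    unfolding bs_def using b_nonneg that by (intro sum_nonneg) auto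
  have hmin_le: "hmin t \<le> h k t" if "k \<in> {1..m}" for k t
    unfolding hmin_def using that by (intro Min_le) auto
  have hmin_less: "hmin t \<le> t" if "0 \<le> t" for t
    using hmin_le[of 1 t] h_le[of 1 t] that m by simp

  \<comment> \<open>The clock and the signs of the two upper limits\<close>
  obtain Ca where Ca: "AE t in lebesgue_on {0..}. a t \<le> Ca" using assms(3) by blast
  obtain A LA EA where A: "\<And>T. LA-lipschitz_on {0..T} A" "A 0 = 0" "negligible EA"
    "\<And>t. \<lbrakk>t > 0; t \<notin> EA\<rbrakk> \<Longrightarrow> (A has_real_derivative a t) (at t)"
    "\<And>u v. \<lbrakk>0 \<le> u; u \<le> v\<rbrakk> \<Longrightarrow> a0 * (v - u) \<le> A v - A u"
    "\<And>u v. \<lbrakk>0 \<le> u; u \<le> v\<rbrakk> \<Longrightarrow> (LINT s:{u..v}|lebesgue. a s) = A v - A u"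
    by (rule integral_clock[OF assms(2) Ca a_ge a0]) (assumption | rule that)+
  have A_mono: "A u \<le> A v" if "0 \<le> u" "u \<le> v" for u v
  proof -
    have "0 \<le> a0 * (v - u)" using a0 that by simp
    then show ?thesis using A(5)[OF that] by simp
  qed

  \<comment> \<open>Only when the delay window lies in [0, \<infinity>) is the integral behind
    \<open>h0\<close> an increment of \<open>A\<close>.\<close>
  have ev_pos: "eventually (\<lambda>t. 0 \<le> hmin t \<and> 0 \<le> t) at_top"
  proof -
    have "eventually (\<lambda>t. \<forall>k\<in>{1..m}. 0 \<le> h k t) at_top"
      using assms(9) by (intro eventually_ball_finite) (auto simp: filterlim_at_top)
    then show ?thesis
      using eventually_ge_at_top[of 0]
      by eventually_elim (use m in \<open>auto simp: hmin_def\<close>)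
  qed
  have "0 \<le> ereal \<beta>"
    unfolding assms(15)
  proof (rule le_Limsup)
    show "eventually (\<lambda>t. 0 \<le> ereal ((\<Sum>k=1..m. b k t) / a t)) at_top"
      using eventually_ge_at_top[of 0]
    proof eventually_elim
      case (elim t)
      then show ?case using bs_nonneg[OF elim] a_ge[OF elim] a0 by (simp add: bs_def)
    qed
  qed simp
  then have \<beta>: "0 \<le> \<beta>" by simp
  have "0 \<le> ereal h0"
    unfolding assms(14)
  proof (rule le_Limsup)
    show "eventually (\<lambda>t. 0 \<le> ereal (LINT s:{(MIN k\<in>{1..m}. h k t)..t}|lebesgue. a s)) at_top"
      using ev_pos
    proof eventually_elim
      case (elim t)
      then show ?case
        using A(6)[of "hmin t" t] A_mono[of "hmin t" t] hmin_less[of t] by (simp add: hmin_def)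
    qed
  qed simp
  then have h0: "0 \<le> h0" by simp

  \<comment> \<open>Perturbed constants and the waiting times\<close>
  obtain B H where BH: "\<beta> < B" "h0 < H" "1 / B * exp (- H) > ln ((B\<^sup>2 + B) / (B\<^sup>2 + 1))"
    using threshold_perturbation[OF \<beta> assms(16)] by blast
  have B: "0 < B" and H: "0 \<le> H" using BH \<beta> h0 by auto
  \<comment> \<open>The midpoint leaves room on both sides: above \<beta> for the upper limit, below
    \<open>B\<close> for the price of the weight.\<close>
  define \<beta>1 where "\<beta>1 = (\<beta> + B) / 2"
  have \<beta>1: "\<beta> < \<beta>1" "\<beta>1 < B" using BH by (auto simp: \<beta>1_def)
  obtain \<epsilon> where \<epsilon>: "0 < \<epsilon>" "\<epsilon> < 1" "\<beta>1 * exp (\<epsilon> * H) \<le> (1 - \<epsilon>) * B"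
    using discount_rate[OF \<beta>1(2)] by blast

  have "eventually (\<lambda>t. ereal (LINT s:{(MIN k\<in>{1..m}. h k t)..t}|lebesgue. a s) < ereal H) at_top"
    using BH(2) by (intro Limsup_lessD) (simp only: assms(14)[symmetric] less_ereal.simps)
  moreover have "eventually (\<lambda>t. ereal ((\<Sum>k=1..m. b k t) / a t) < ereal \<beta>1) at_top"
    using \<beta>1(1) by (intro Limsup_lessD) (simp only: assms(15)[symmetric] less_ereal.simps)
  ultimately have "eventually (\<lambda>t. 0 \<le> t \<and> 0 \<le> hmin t \<and> A t - A (hmin t) \<le> H \<and> bs t \<le> \<beta>1 * a t) at_top"
    using ev_pos
  proof eventually_elim
    case (elim t)
    then have "bs t / a t < \<beta>1" "a t > 0" using a_ge[of t] a0 by (auto simp: bs_def)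
    then have "bs t \<le> \<beta>1 * a t" by (simp add: field_simps)
    then show ?case using elim A(6)[of "hmin t" t] hmin_less[of t] by (simp add: hmin_def)
  qed
  then obtain T1' where "\<And>t. t \<ge> T1' \<Longrightarrow> 0 \<le> t \<and> 0 \<le> hmin t \<and> A t - A (hmin t) \<le> H \<and> bs t \<le> \<beta>1 * a t"
    unfolding eventually_at_top_linorder by blast
  then obtain T1 where T1: "0 \<le> T1" "\<And>t. t \<ge> T1 \<Longrightarrow> 0 \<le> hmin t"
    "\<And>t. t \<ge> T1 \<Longrightarrow> A t - A (hmin t) \<le> H" "\<And>t. t \<ge> T1 \<Longrightarrow> bs t \<le> \<beta>1 * a t"
    by (metis order_refl)
  define D where "D t = (1 - \<epsilon>) * A t" for t
  \<comment> \<open>The clock \<open>D\<close> runs at least at speed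
    \<open>(1 - \<epsilon>) * a0\<close>, so this stretch of time covers two delays.\<close>
  define T3 where "T3 = T1 + 2 * H / ((1 - \<epsilon>) * a0)"
  have T3: "T1 \<le> T3" using H \<epsilon> a0 by (simp add: T3_def)
  have DT3: "D T3 \<ge> D T1 + 2 * H"
  proof -
    have "2 * H = (1 - \<epsilon>) * (a0 * (T3 - T1))" using \<epsilon> a0 by (simp add: T3_def)
    also have "\<dots> \<le> (1 - \<epsilon>) * (A T3 - A T1)" using A(5)[OF T1(1) T3] \<epsilon> by (intro mult_left_mono) auto
    finally show ?thesis by (simp add: D_def algebra_simps)
  qed
  have D_lip: "((1 - \<epsilon>) * LA)-lipschitz_on {0..T} D" for T
    unfolding D_def using lipschitz_on_cmult_real[OF A(1), of "1 - \<epsilon>" T] \<epsilon> by simp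
  have D_mono: "strict_mono_on {0..} D"
  proof (rule strict_mono_onI)
    fix u v :: real assume "u \<in> {0..}" "v \<in> {0..}" "u < v"
    then have "0 < a0 * (v - u)" "a0 * (v - u) \<le> A v - A u" using a0 A(5)[of u v] by auto
    then show "D u < D v" using \<epsilon> by (simp add: D_def)
  qed

  \<comment> \<open>Almost-everywhere bounds on the coefficients\<close>
  have "\<exists>C E. negligible E \<and> 0 \<le> C \<and> (\<forall>t\<ge>0. t \<notin> E \<longrightarrow> b k t \<le> C \<and>
      stieltjes_integral (R k t) (h k t) t (\<lambda>_. 1) = 1)" if k: "k \<in> {1..m}" for k
  proof -
    obtain C where "AE t in lebesgue_on {0..}. b k t \<le> C" using assms(5)[OF k] by blast
    with assms(11)[OF k]
    have "AE t in lebesgue_on {0..}. b k t \<le> C \<and> stieltjes_integral (R k t) (h k t) t (\<lambda>_. 1) = 1"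
      by eventually_elim auto
    then obtain E where "negligible E" "\<And>t. \<lbrakk>0 \<le> t; t \<notin> E\<rbrakk> \<Longrightarrow> b k t \<le> C \<and>
      stieltjes_integral (R k t) (h k t) t (\<lambda>_. 1) = 1"
      using AE_lebesgue_on_nonneg_obtain by blast
    then show ?thesis by (intro exI[of _ "max C 0"] exI[of _ E]) (auto intro: max.coboundedI1)
  qed
  then obtain Cb Eb where CE: "\<And>k. k \<in> {1..m} \<Longrightarrow> negligible (Eb k) \<and> 0 \<le> Cb k \<and>
      (\<forall>t\<ge>0. t \<notin> Eb k \<longrightarrow> b k t \<le> Cb k \<and> stieltjes_integral (R k t) (h k t) t (\<lambda>_. 1) = 1)"
    by metis
  have Eb: "\<And>k. k \<in> {1..m} \<Longrightarrow> negligible (Eb k)"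
    and Cb: "\<And>k. k \<in> {1..m} \<Longrightarrow> 0 \<le> Cb k"
      "\<And>k t. \<lbrakk>k \<in> {1..m}; 0 \<le> t; t \<notin> Eb k\<rbrakk> \<Longrightarrow> b k t \<le> Cb k"
    and one: "\<And>k t. \<lbrakk>k \<in> {1..m}; 0 \<le> t; t \<notin> Eb k\<rbrakk> \<Longrightarrow>
      stieltjes_integral (R k t) (h k t) t (\<lambda>_. 1) = 1"
    using CE by blast+
  obtain Ea where Ea: "negligible Ea" "\<And>t. \<lbrakk>0 \<le> t; t \<notin> Ea\<rbrakk> \<Longrightarrow> a t \<le> Ca"
    using AE_lebesgue_on_nonneg_obtain[OF Ca] by blast
  define E0 where "E0 = Ea \<union> EA \<union> (\<Union>k\<in>{1..m}. Eb k)"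
  have E0: "negligible E0"
    unfolding E0_def using Ea A Eb by (intro negligible_Un negligible_Union) auto
  define L where "L = max Ca 0 + (\<Sum>k=1..m. Cb k)"
  have L: "0 \<le> L" unfolding L_def using Cb by (intro add_nonneg_nonneg sum_nonneg) auto
  \<comment> \<open>\<open>exp (L * T3)\<close> covers the growth of \<open>x\<close> up to
    \<open>T3\<close>, the other factor the weight; neither depends on the initial function.\<close>
  define M where "M = exp (\<epsilon> * A T3) * exp (L * T3)"

  \<comment> \<open>The decay estimate for a single solution\<close>
  have decay: "\<bar>x t\<bar> \<le> M * initial_norm \<phi> * exp (- (\<epsilon> * a0) * t)"
    if \<phi>: "admissible_initial \<phi>" and sol: "is_solution m a b h R \<phi> x" and t: "0 \<le> t" for \<phi> x t
  proof -
    define I where "I k t = stieltjes_integral (R k t) (h k t) t x" for k t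
    define K where "K = initial_norm \<phi>"
    have x_ac: "abs_continuous_interval x 0 T" if "T \<ge> 0" for T
      using sol that by (simp add: is_solution_def)
    have x_cont: "continuous_on UNIV x" by (rule solution_continuous[OF \<phi> sol])
    have x_init: "\<bar>x s\<bar> \<le> K" if "s \<le> 0" for s
      using sol initial_norm_ge[OF \<phi> that] that by (simp add: is_solution_def K_def)
    have "AE t in lebesgue_on {0..}. \<exists>x'. (x has_real_derivative x') (at t) \<and>
        x' + a t * x t + (\<Sum>k=1..m. b k t * I k t) = 0"
      using sol by (simp add: is_solution_def I_def)
    then obtain Ex where Ex: "negligible Ex" "\<And>t. \<lbrakk>0 \<le> t; t \<notin> Ex\<rbrakk> \<Longrightarrow>
        \<exists>x'. (x has_real_derivative x') (at t) \<and> x' + a t * x t + (\<Sum>k=1..m. b k t * I k t) = 0"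
      using AE_lebesgue_on_nonneg_obtain by blast
    define E where "E = E0 \<union> Ex"
    have E: "negligible E" unfolding E_def using E0 Ex by (intro negligible_Un)
    have I_ge: "c \<le> I k t" if "k \<in> {1..m}" "0 \<le> t" "t \<notin> E" "\<And>s. \<lbrakk>h k t \<le> s; s \<le> t\<rbrakk> \<Longrightarrow> c \<le> x s" for k t c
      unfolding I_def using that
      by (intro stieltjes_integral_one_sided_bounds(1)[OF one x_cont]) (auto simp: E_def E0_def)
    have I_le: "I k t \<le> c" if "k \<in> {1..m}" "0 \<le> t" "t \<notin> E" "\<And>s. \<lbrakk>h k t \<le> s; s \<le> t\<rbrakk> \<Longrightarrow> x s \<le> c" for k t c
      unfolding I_def using that
      by (intro stieltjes_integral_one_sided_bounds(2)[OF one x_cont]) (auto simp: E_def E0_def)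
    have growth: "\<bar>x t\<bar> \<le> K * exp (L * t)" if "0 \<le> t" for t
    proof (rule exponential_growth_bound[OF x_ac x_init L E _ that])
      fix t :: real assume t: "0 < t" "t \<notin> E"
      then obtain x' where x': "(x has_real_derivative x') (at t)"
        "x' + a t * x t + (\<Sum>k=1..m. b k t * I k t) = 0" using Ex(2)[of t] by (auto simp: E_def)
      have "\<bar>x'\<bar> \<le> L * C" if C: "\<forall>s\<le>t. \<bar>x s\<bar> \<le> C" for C
      proof -
        have C0: "0 \<le> C" using C by (metis abs_ge_zero order_refl order_trans)
        have "\<bar>a t * x t\<bar> \<le> max Ca 0 * C"
          unfolding abs_mult using Ea(2)[of t] a_ge[of t] a0 t C C0
          by (intro mult_mono) (auto simp: E_def E0_def)
        moreover have "\<bar>\<Sum>k=1..m. b k t * I k t\<bar> \<le> (\<Sum>k=1..m. Cb k * C)"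
        proof (rule order_trans[OF sum_abs], rule sum_mono)
          fix k assume k: "k \<in> {1..m}"
          have "\<bar>I k t\<bar> \<le> C"
            using I_ge[OF k, of t "- C"] I_le[OF k, of t C] C t by (force simp: abs_le_iff)
          then show "\<bar>b k t * I k t\<bar> \<le> Cb k * C"
            unfolding abs_mult using Cb(1)[OF k] Cb(2)[OF k, of t] b_nonneg[OF k, of t] t k C0
            by (intro mult_mono) (auto simp: E_def E0_def)
        qed
        ultimately show ?thesis
          using x'(2) by (simp add: L_def distrib_right sum_distrib_right[symmetric])
      qed
      then show "\<exists>x'. (x has_real_derivative x') (at t) \<and>
        (\<forall>C. (\<forall>s\<le>t. \<bar>x s\<bar> \<le> C) \<longrightarrow> \<bar>x'\<bar> \<le> L * C)" using x'(1) by blast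
    qed
    define y where "y t = exp (\<epsilon> * A t) * x t" for t
    have x_y: "x t = exp (- (\<epsilon> * A t)) * y t" for t by (simp add: y_def exp_minus)
    have "\<bar>y t\<bar> \<le> M * K"
    proof (rule bounded_by_history[OF B H BH(3) D_lip D_mono _ E _ T1(1) T3 DT3 _ t])
      show "abs_continuous_interval y 0 T" if "T \<ge> 0" for T
      proof -
        have "\<exists>N. N-lipschitz_on {0..T} (\<lambda>t. exp (\<epsilon> * A t))"
          by (rule lipschitz_on_C1_compose[OF A(1), where G' = "\<lambda>v. \<epsilon> * exp (\<epsilon> * v)"])
             (auto intro!: derivative_eq_intros continuous_intros)
        then show ?thesis
          unfolding y_def
          by (auto intro!: abs_continuous_interval_mult x_ac that intro: abs_continuous_interval_lipschitz)
      qed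
    next
      fix s assume s: "0 \<le> s" "s \<le> T3"
      have K0: "0 \<le> K" using x_init[of 0] by simp
      have "\<bar>y s\<bar> \<le> exp (\<epsilon> * A s) * (K * exp (L * s))"
        using growth[OF s(1)] by (simp add: y_def abs_mult)
      also have "\<dots> \<le> exp (\<epsilon> * A T3) * (K * exp (L * T3))"
        using A_mono[OF s] s L K0 \<epsilon> by (intro mult_mono) (auto intro!: mult_left_mono)
      finally show "\<bar>y s\<bar> \<le> M * K" by (simp add: M_def mult_ac)
    next
      fix t assume t: "T1 < t" "t \<notin> E"
      then have t0: "0 < t" using T1 by simp
      then obtain x' where x': "(x has_real_derivative x') (at t)"
        "x' + a t * x t + (\<Sum>k=1..m. b k t * I k t) = 0" using Ex(2)[of t] t by (auto simp: E_def)
      have dA: "(A has_real_derivative a t) (at t)" using A(4)[OF t0] t by (auto simp: E_def E0_def)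
      define y' where "y' = exp (\<epsilon> * A t) * (x' + \<epsilon> * a t * x t)"
      define S where "S = (\<Sum>k=1..m. b k t * (exp (\<epsilon> * A t) * I k t))"
      have dy: "(y has_real_derivative y') (at t)"
        unfolding y_def[abs_def] y'_def
        by (auto intro!: derivative_eq_intros dA x'(1) simp: algebra_simps)
      have dD: "(D has_real_derivative (1 - \<epsilon>) * a t) (at t)"
        unfolding D_def[abs_def] by (intro DERIV_cmult dA)
      have at: "0 \<le> (1 - \<epsilon>) * a t" using a_ge[of t] a0 t0 \<epsilon> by simp
      \<comment> \<open>Differentiating the weight contributes
        \<open>\<epsilon> * a t * y t\<close>. Together with the damping term this completes
        \<open>a t * y t\<close>, so the equation for \<open>x\<close> can be inserted.\<close>
      have eq: "y' + (1 - \<epsilon>) * a t * y t = - S"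
      proof -
        have "y' + (1 - \<epsilon>) * a t * y t = exp (\<epsilon> * A t) * (x' + a t * x t)"
          by (simp add: y'_def y_def algebra_simps)
        also have "\<dots> = exp (\<epsilon> * A t) * - (\<Sum>k=1..m. b k t * I k t)"
          using x'(2) by (intro arg_cong[of _ _ "(*) _"]) linarith
        finally show ?thesis by (simp add: S_def sum_distrib_left mult_ac)
      qed
      \<comment> \<open>From \<open>T1\<close> on, delays are at most \<open>H\<close> in the clock
        \<open>A\<close>, hence also in the slower clock \<open>D\<close>.\<close>
      have window: "0 \<le> s" "D t - D s \<le> H" "\<epsilon> * (A t - A s) \<le> \<epsilon> * H"
        if "k \<in> {1..m}" "h k t \<le> s" "s \<le> t" for k s
      proof -
        have s: "hmin t \<le> s" using hmin_le[OF that(1), of t] that(2) by simp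
        then show s0: "0 \<le> s" using T1(2)[of t] t by simp
        have AH: "A t - A s \<le> H"
          using T1(3)[of t] t A_mono[OF _ s] T1(2)[of t] by simp
        then show "\<epsilon> * (A t - A s) \<le> \<epsilon> * H" using \<epsilon> by simp
        have "(1 - \<epsilon>) * (A t - A s) \<le> 1 * (A t - A s)"
          using \<epsilon> A_mono[OF s0 that(3)] by (intro mult_right_mono) auto
        then show "D t - D s \<le> H" using AH by (simp add: D_def algebra_simps)
      qed
      \<comment> \<open>By the choice of \<open>\<epsilon>\<close>, even the inflated feedback is at
        most \<open>B\<close> times the speed \<open>(1 - \<epsilon>) * a t\<close> of
        \<open>D\<close>.\<close>
      have total: "bs t * (exp (\<epsilon> * H) * c) \<le> (1 - \<epsilon>) * a t * B * c" if "0 \<le> c" for c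
      proof -
        have "bs t * (exp (\<epsilon> * H) * c) \<le> (\<beta>1 * a t) * (exp (\<epsilon> * H) * c)"
          using T1(4)[of t] t that by (intro mult_right_mono) auto
        also have "\<dots> = (\<beta>1 * exp (\<epsilon> * H)) * (a t * c)" by (simp add: mult_ac)
        also have "\<dots> \<le> ((1 - \<epsilon>) * B) * (a t * c)"
          using \<epsilon> that a_ge[of t] a0 t0 by (intro mult_right_mono) auto
        finally show ?thesis by (simp add: mult_ac)
      qed
      have scale: "exp (\<epsilon> * (A t - A s)) * c \<le> exp (\<epsilon> * H) * c"
        if "0 \<le> c" "k \<in> {1..m}" "h k t \<le> s" "s \<le> t" for c k s
        using window(3)[OF that(2-4)] that(1) by (intro mult_right_mono) auto
      \<comment> \<open>The solution at an earlier time, weighted at \<open>t\<close>, is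
        \<open>y\<close> there times the ratio of the two weights; \<open>scale\<close> bounds this
        ratio over one delay.\<close>
      have split: "exp (\<epsilon> * A t) * x s = exp (\<epsilon> * (A t - A s)) * y s" for s
        by (simp add: x_y right_diff_distrib exp_diff exp_minus field_simps)
      have upper: "y' + (1 - \<epsilon>) * a t * y t \<le> (1 - \<epsilon>) * a t * B * c"
        if c: "c \<ge> 0" "\<forall>s\<in>{0..t}. D t - D s \<le> H \<longrightarrow> - c \<le> y s" for c
      proof -
        have "- (exp (\<epsilon> * H) * c) \<le> exp (\<epsilon> * A t) * I k t" if k: "k \<in> {1..m}" for k
        proof -
          have "- (exp (\<epsilon> * H) * c) / exp (\<epsilon> * A t) \<le> I k t"
          proof (rule I_ge[OF k less_imp_le[OF t0] t(2)])
            fix s assume s: "h k t \<le> s" "s \<le> t"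
            have "- (exp (\<epsilon> * H) * c) \<le> exp (\<epsilon> * (A t - A s)) * (- c)"
              using scale[OF c(1) k s] by simp
            also have "\<dots> \<le> exp (\<epsilon> * (A t - A s)) * y s"
              using c(2) window(1,2)[OF k s] s by (intro mult_left_mono) auto
            finally have "- (exp (\<epsilon> * H) * c) \<le> exp (\<epsilon> * A t) * x s" by (simp only: split)
            then show "- (exp (\<epsilon> * H) * c) / exp (\<epsilon> * A t) \<le> x s"
              by (subst pos_divide_le_eq) (simp_all add: mult.commute)
          qed
          then show ?thesis by (subst (asm) pos_divide_le_eq) (simp_all add: mult.commute)
        qed
        then have "(\<Sum>k=1..m. b k t * - (exp (\<epsilon> * H) * c)) \<le> S"
          unfolding S_def using b_nonneg t0 by (intro sum_mono mult_left_mono) auto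
        then have "- (bs t * (exp (\<epsilon> * H) * c)) \<le> S"
          by (simp add: bs_def sum_distrib_right sum_negf)
        then show ?thesis using total[OF c(1)] eq by linarith
      qed
      have lower: "- ((1 - \<epsilon>) * a t * B * c) \<le> y' + (1 - \<epsilon>) * a t * y t"
        if c: "c \<ge> 0" "\<forall>s\<in>{0..t}. D t - D s \<le> H \<longrightarrow> y s \<le> c" for c
      proof -
        have "exp (\<epsilon> * A t) * I k t \<le> exp (\<epsilon> * H) * c" if k: "k \<in> {1..m}" for k
        proof -
          have "I k t \<le> (exp (\<epsilon> * H) * c) / exp (\<epsilon> * A t)"
          proof (rule I_le[OF k less_imp_le[OF t0] t(2)])
            fix s assume s: "h k t \<le> s" "s \<le> t"
            have "exp (\<epsilon> * (A t - A s)) * y s \<le> exp (\<epsilon> * (A t - A s)) * c"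
              using c(2) window(1,2)[OF k s] s by (intro mult_left_mono) auto
            also have "\<dots> \<le> exp (\<epsilon> * H) * c" by (rule scale[OF c(1) k s])
            finally have "exp (\<epsilon> * A t) * x s \<le> exp (\<epsilon> * H) * c" by (simp only: split)
            then show "x s \<le> (exp (\<epsilon> * H) * c) / exp (\<epsilon> * A t)"
              by (subst pos_le_divide_eq) (simp_all add: mult.commute)
          qed
          then show ?thesis by (subst (asm) pos_le_divide_eq) (simp_all add: mult.commute)
        qed
        then have "S \<le> (\<Sum>k=1..m. b k t * (exp (\<epsilon> * H) * c))"
          unfolding S_def using b_nonneg t0 by (intro sum_mono mult_left_mono) auto
        then have "S \<le> bs t * (exp (\<epsilon> * H) * c)"
          by (simp add: bs_def sum_distrib_right)
        then show ?thesis using total[OF c(1)] eq by linarith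
      qed
      show "\<exists>y' a. a \<ge> 0 \<and> (y has_real_derivative y') (at t) \<and>
        (D has_real_derivative a) (at t) \<and>
        (\<forall>c\<ge>0. (\<forall>s\<in>{0..t}. D t - D s \<le> H \<longrightarrow> - c \<le> y s) \<longrightarrow> y' + a * y t \<le> a * B * c) \<and>
        (\<forall>c\<ge>0. (\<forall>s\<in>{0..t}. D t - D s \<le> H \<longrightarrow> y s \<le> c) \<longrightarrow> - (a * B * c) \<le> y' + a * y t)"
        using at dy dD upper lower by blast
    qed
    then have "\<bar>x t\<bar> \<le> exp (- (\<epsilon> * A t)) * (M * K)"
      unfolding x_y abs_mult by (simp add: mult_left_mono)
    \<comment> \<open>Decay in the clock becomes decay in time because the clock runs at least at
      speed \<open>a0\<close>; this is the origin of the rate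
      \<open>\<epsilon> * a0\<close>.\<close>
    also have "\<dots> \<le> exp (- (\<epsilon> * a0 * t)) * (M * K)"
    proof (rule mult_right_mono)
      have "a0 * t \<le> A t" using A(5)[of 0 t] A(2) t by simp
      then show "exp (- (\<epsilon> * A t)) \<le> exp (- (\<epsilon> * a0 * t))" using \<epsilon> by (simp add: mult.assoc)
      show "0 \<le> M * K" using x_init[of 0] by (simp add: M_def)
    qed
    finally show ?thesis by (simp add: K_def mult_ac)
  qed
  show ?thesis
    unfolding exponentially_stable_def
  proof (intro exI conjI allI impI)
    show "0 < M" by (simp add: M_def)
    show "0 < \<epsilon> * a0" using \<epsilon> a0 by simp
  qed (rule decay)
qed

end
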